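(* The first quadrant Mordell-Gruber spectrum $\mathrm{MG}_2^+$ contains a Hall's ray: there exists $K>0$ such that $[K,\infty]\subset\mathrm{MG}_2^+$.
   Context: A unimodular lattice in $\mathbb{R}^2$ is $\Lambda=\mathbb{Z}A+\mathbb{Z}B$ with $|\det(A;B)|=1$. A rectangle $[0,x]\times[0,y]$ ($x,y>0$) is admissible in $\Lambda$ if $([0,x]\times[0,y])\cap\Lambda=\{(0,0)\}$. Put $\kappa^+(\Lambda)=\sup xy\in[0,\infty]$, the supremum over all admissible rectangles $[0,x]\times[0,y]$, and $\mathrm{MG}_2^+=\{\kappa^+(\Lambda):\Lambda\text{ a unimodular lattice in }\mathbb{R}^2\}$. *)

theory Defs
  imports "HOL-Analysis.Analysis"
begin

definition lattice_span :: "real^2 \<Rightarrow> real^2 \<Rightarrow> (real^2) set" where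
  "lattice_span A B = {of_int m *\<^sub>R A + of_int n *\<^sub>R B | m n :: int. True}"

definition unimodular_lattice :: "(real^2) set \<Rightarrow> bool" where
  "unimodular_lattice \<Lambda> \<longleftrightarrow>
     (\<exists>A B. \<Lambda> = lattice_span A B \<and> \<bar>det (vector [A, B] :: real^2^2)\<bar> = 1)"

definition admissible :: "(real^2) set \<Rightarrow> real \<Rightarrow> real \<Rightarrow> bool" where
  "admissible \<Lambda> x y \<longleftrightarrow> 0 < x \<and> 0 < y \<and> cbox 0 (vector [x, y]) \<inter> \<Lambda> = {0}"

definition kappa_plus :: "(real^2) set \<Rightarrow> ennreal" where
  "kappa_plus \<Lambda> = Sup {ennreal (x * y) | x y. admissible \<Lambda> x y}"

definition MG2_plus :: "ennreal set" where
  "MG2_plus = {kappa_plus \<Lambda> | \<Lambda>. unimodular_lattice \<Lambda>}"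

end

theory Submission
  imports Defs
begin

text \<open>
  The lattice spanned by \<open>P = (U - 1, V d)\<close> and \<open>D = (1, - d)\<close> with \<open>d = 1 / (U + V - 1)\<close> has
  determinant \<open>-1\<close>. If \<open>U\<close> and \<open>V\<close> are large, the points \<open>P + i D\<close> form a long staircase in the first
  quadrant, and the rectangle under two neighbouring points of it has the area
  \<open>(U + i) (V - i) / (U + V - 1)\<close>. If \<open>\<bar>U - V\<bar> \<le> 1\<close>, the largest of these areas is the one
  at \<open>i = 0\<close>, namely \<open>U V / (U + V - 1)\<close>, about \<open>(U + V) / 4\<close>. Beyond the two ends of the
  staircase the lattice is governed by the continued fractions of the fractional parts of \<open>V\<close> and \<open>U\<close>. If
  their digits are at most 10, then the rectangles found there have areas of at most 11
  (\<open>tail_box_bound\<close>), so that the supremum is \<open>U V / (U + V - 1)\<close>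
  (\<open>center_box_bound\<close>, \<open>center_box_empty\<close>).

  For a large real number \<open>t\<close> it remains to solve \<open>U V = t (U + V - 1)\<close> with \<open>\<bar>U - V\<bar> \<le> 1\<close>, where the
  fractional parts of \<open>U\<close> and \<open>V\<close> belong to the Cantor set given by the digits 1 to 10. This is the
  situation of Hall's theorem on sums of continued fractions with bounded digits, with a function of two
  variables in place of the sum. The Cantor set arises by removing gaps from intervals; each gap is at most
  half as long as the two bridges next to it, and gaps get smaller
  from one generation to the next. Given a box on which the function changes sign, one removes the larger
  of the two gaps of its sides; the function changes sign on one of the two
  remaining boxes as well, because the gap is short compared with the other side
  (\<open>straddles_step\<close>). In the limit a zero in the product of the Cantor sets is found
  (\<open>exists_zero\<close>). For large \<open>t\<close> the function has almost equal partial derivatives,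
  which leaves ample room for the distortion.

  The value \<open>\<infinity>\<close> is attained by the lattice of the points \<open>(m, k - m \<sigma>)\<close> for a number \<open>\<sigma>\<close> with
  extremely good rational approximations from below (\<open>infinity_in_MG2_plus\<close>).
\<close>

section \<open>Interleaved splitting of a tree of bridges and gaps\<close>

text \<open>
  A step of size \<open>d - c\<close> in the first variable is outweighed by a step that is \<open>k\<close> times
  longer in the second. For a smooth function that increases in both variables this follows if the
  first partial derivative is at most \<open>k\<close> times the second one, at whatever points
  the two are taken; for a sum, \<open>k = 1\<close> is enough.
\<close>

definition exchange :: "real \<Rightarrow> real \<Rightarrow> real \<Rightarrow> (real \<Rightarrow> real \<Rightarrow> real) \<Rightarrow> bool" where
  "exchange k l u G \<longleftrightarrow>
     (\<forall>c d v w. l \<le> c \<and> c \<le> d \<and> d \<le> u \<and> l \<le> v \<and> v \<le> w \<and> w \<le> u \<and> k * (d - c) \<le> w - v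
        \<longrightarrow> G d v \<le> G c w)"

text \<open>
  A node \<open>(a, c, d, b)\<close> stands for the interval \<open>[a, b]\<close> with the open gap \<open>(c, d)\<close> removed; the
  two bridges \<open>[a, c]\<close> and \<open>[d, b]\<close> are the intervals of its two children. Each bridge is at
  least \<open>k\<close> times as long as the gap between them, so \<open>k\<close> is a lower bound for the thickness
  of the Cantor set that the tree describes. Gaps shrink geometrically along a branch, and
  a node is short if its gap is short; together these make the nodes shrink to points.
\<close>

locale bridge_tree =
  fixes S :: "real set" and T :: "(real \<times> real \<times> real \<times> real) set" and k r L :: real
  assumes compact_S: "compact S"
    and k_nonneg: "0 \<le> k" and r_pos: "0 < r" and r_less: "r < 1"
    and node: "(a, c, d, b) \<in> T \<Longrightarrow> a < c \<and> c < d \<and> d < b \<and> a \<in> S \<and> b \<in> S"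
    and bridges: "(a, c, d, b) \<in> T \<Longrightarrow> k * (d - c) \<le> c - a \<and> k * (d - c) \<le> b - d"
    and length: "(a, c, d, b) \<in> T \<Longrightarrow> b - a \<le> L * (d - c)"
    and left: "(a, c, d, b) \<in> T \<Longrightarrow> \<exists>c' d'. (a, c', d', c) \<in> T \<and> d' - c' \<le> r * (d - c)"
    and right: "(a, c, d, b) \<in> T \<Longrightarrow> \<exists>c' d'. (d, c', d', b) \<in> T \<and> d' - c' \<le> r * (d - c)"
begin

text \<open>
  If the second coordinate varies over an interval that is long compared with the gap, then
  no sign change of \<open>G\<close> is lost by removing the gap: either \<open>G c w \<ge> 0\<close> and the left child still
  has the sign change, or \<open>G d v \<le> G c w < 0\<close> and the right child has it.
\<close>

lemma split_node:
  assumes I: "(a, c, d, b) \<in> T" and G: "exchange k l u G"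
    and J: "l \<le> a" "b \<le> u" "l \<le> v" "v \<le> w" "w \<le> u"
    and gap: "k * (d - c) \<le> w - v" and neg: "G a v \<le> 0" and pos: "0 \<le> G b w"
  shows "\<exists>a1 c1 d1 b1. (a1, c1, d1, b1) \<in> T \<and> a \<le> a1 \<and> b1 \<le> b \<and> d1 - c1 \<le> r * (d - c)
           \<and> k * (d - c) \<le> b1 - a1 \<and> G a1 v \<le> 0 \<and> 0 \<le> G b1 w"
proof (cases "0 \<le> G c w")
  case True
  obtain c' d' where "(a, c', d', c) \<in> T" "d' - c' \<le> r * (d - c)"
    using left[OF I] by blast
  then show ?thesis
    using True neg node[OF I] bridges[OF I] by (intro exI[of _ a] exI[of _ c'] exI[of _ d'] exI[of _ c]) auto
next
  case False
  obtain c' d' where 1: "(d, c', d', b) \<in> T" "d' - c' \<le> r * (d - c)"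
    using right[OF I] by blast
  have "G d v \<le> G c w"
    using G J gap node[OF I] unfolding exchange_def by force
  then show ?thesis
    using 1 False pos node[OF I] bridges[OF I] by (intro exI[of _ d] exI[of _ c'] exI[of _ d'] exI[of _ b]) auto
qed

text \<open>
  The invariant of the construction: \<open>G\<close> changes sign between the lower left and the upper
  right corner of the box, and the gap of each side is short compared with the other side.
\<close>

definition straddles :: "real \<Rightarrow> real \<Rightarrow> (real \<Rightarrow> real \<Rightarrow> real) \<Rightarrow>
    real \<times> real \<times> real \<times> real \<Rightarrow> real \<times> real \<times> real \<times> real \<Rightarrow> bool" where
  "straddles l u G = (\<lambda>(a, c, d, b) (a', c', d', b').
     (a, c, d, b) \<in> T \<and> (a', c', d', b') \<in> T \<and> l \<le> a \<and> b \<le> u \<and> l \<le> a' \<and> b' \<le> u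
     \<and> k * (d - c) \<le> b' - a' \<and> k * (d' - c') \<le> b - a \<and> G a a' \<le> 0 \<and> 0 \<le> G b b')"

lemma straddles_swap:
  "straddles l u G I J \<Longrightarrow> straddles l u (\<lambda>x y. G y x) J I"
  by (auto simp: straddles_def split: prod.splits)

abbreviation gap :: "real \<times> real \<times> real \<times> real \<Rightarrow> real" where
  "gap \<equiv> \<lambda>(a, c, d, b). d - c"

text \<open>
  Splitting the side with the larger gap keeps the invariant. The gap of the child is no
  larger than that of its parent, and the child itself is a bridge of a gap that dominates
  the gap of the other side.
\<close>

lemma straddles_step:
  assumes st: "straddles l u G I J" and G: "exchange k l u G" and le: "gap J \<le> gap I"
  shows "\<exists>I'. straddles l u G I' J \<and> gap I' \<le> r * gap I"
proof -
  obtain a c d b a' c' d' b' where IJ: "I = (a, c, d, b)" "J = (a', c', d', b')"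
    by (metis prod_cases4)
  have *: "(a, c, d, b) \<in> T" "(a', c', d', b') \<in> T" "l \<le> a" "b \<le> u" "l \<le> a'" "b' \<le> u"
     "k * (d - c) \<le> b' - a'" "k * (d' - c') \<le> b - a" "G a a' \<le> 0" "0 \<le> G b b'"
    using st by (auto simp: straddles_def IJ)
  obtain a1 c1 d1 b1 where 1: "(a1, c1, d1, b1) \<in> T" "a \<le> a1" "b1 \<le> b" "d1 - c1 \<le> r * (d - c)"
           "k * (d - c) \<le> b1 - a1" "G a1 a' \<le> 0" "0 \<le> G b1 b'"
    using split_node[OF *(1) G *(3,4,5) _ *(6,7,9,10)] node[OF *(2)] by auto
  have "r * (d - c) \<le> 1 * (d - c)"
    using r_less node[OF *(1)] by (intro mult_right_mono) auto
  then have "k * (d1 - c1) \<le> k * (d - c)"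
    using 1(4) k_nonneg by (intro mult_left_mono) auto
  moreover have "k * (d' - c') \<le> k * (d - c)"
    using le k_nonneg by (intro mult_left_mono) (auto simp: IJ)
  ultimately have "straddles l u G (a1, c1, d1, b1) J"
    using 1 * by (auto simp: straddles_def IJ)
  then show ?thesis
    using 1(4) by (intro exI[of _ "(a1, c1, d1, b1)"]) (auto simp: IJ)
qed

text \<open>
  Whichever side is split, its exponent drops by one, so \<open>m + n\<close> decreases until both gaps are
  below \<open>e\<close>.
\<close>

lemma straddles_small:
  assumes G: "exchange k l u G" "exchange k l u (\<lambda>x y. G y x)" and e: "0 < e"
  shows "straddles l u G I J \<Longrightarrow> r ^ m * gap I < e \<Longrightarrow> r ^ n * gap J < e \<Longrightarrow>
    \<exists>I J. straddles l u G I J \<and> gap I < e \<and> gap J < e"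
proof (induction "m + n" arbitrary: m n I J rule: less_induct)
  case less
  show ?case
  proof (cases "gap I < e \<and> gap J < e")
    case True
    then show ?thesis using less.prems by blast
  next
    case nsmall: False
    show ?thesis
    proof (cases "gap J \<le> gap I")
      case True
      obtain I' where I': "straddles l u G I' J" "gap I' \<le> r * gap I"
        using straddles_step[OF less.prems(1) G(1) True] by blast
      have "m \<noteq> 0"
        using less.prems(2) nsmall True by (intro notI) auto
      then obtain m' where m: "m = Suc m'" by (cases m) auto
      have "r ^ m' * gap I' \<le> r ^ m' * (r * gap I)"
        using I'(2) r_pos by (intro mult_left_mono) auto
      also have "\<dots> < e" using less.prems(2) by (simp add: m mult_ac)
      finally show ?thesis
        using less.hyps[of m' n I' J] I'(1) less.prems(3) by (simp add: m)
    next
      case False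
      obtain J' where J': "straddles l u (\<lambda>x y. G y x) J' I" "gap J' \<le> r * gap J"
        using straddles_step[OF straddles_swap[OF less.prems(1)] G(2)] False by auto
      have "n \<noteq> 0"
        using less.prems(3) nsmall False by (intro notI) auto
      then obtain n' where n: "n = Suc n'" by (cases n) auto
      have "r ^ n' * gap J' \<le> r ^ n' * (r * gap J)"
        using J'(2) r_pos by (intro mult_left_mono) auto
      also have "\<dots> < e" using less.prems(3) by (simp add: n mult_ac)
      finally show ?thesis
        using less.hyps[of m n' I J'] straddles_swap[OF J'(1)] less.prems(2) by (simp add: n)
    qed
  qed
qed

text \<open>
  A version of Hall's theorem: the equation \<open>G x y = 0\<close> can be solved inside the Cantor set. The
  corners of the boxes produced by \<open>straddles_small\<close> are points of \<open>S \<times> S\<close> with \<open>G \<le> 0\<close>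
  at one and \<open>G \<ge> 0\<close> at the other, and they come arbitrarily close together; a limit point is a zero.
\<close>

theorem exists_zero:
  assumes root: "(l, c, d, u) \<in> T"
    and G: "exchange k l u G" "exchange k l u (\<lambda>x y. G y x)"
    and cont: "continuous_on UNIV (\<lambda>(x, y). G x y)"
    and sign: "G l l \<le> 0" "0 \<le> G u u"
  shows "\<exists>x\<in>S \<inter> {l..u}. \<exists>y\<in>S \<inter> {l..u}. G x y = 0"
proof -
  let ?K = "(S \<inter> {l..u}) \<times> (S \<inter> {l..u})"
  have st: "straddles l u G (l, c, d, u) (l, c, d, u)"
    using root node[OF root] bridges[OF root] sign by (auto simp: straddles_def)
  have "\<exists>p q. p \<in> ?K \<and> q \<in> ?K \<and> dist p q < e \<and> (\<lambda>(x, y). G x y) p \<le> 0 \<and> 0 \<le> (\<lambda>(x, y). G x y) q"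
    if e: "0 < e" for e :: real
  proof -
    define e' where "e' = e / (2 * (\<bar>L\<bar> + 1))"
    have e': "0 < e'" using e by (auto simp: e'_def intro!: divide_pos_pos)
    have "(\<lambda>n. r ^ n * (d - c)) \<longlonglongrightarrow> 0 * (d - c)"
      using r_pos r_less by (intro tendsto_intros LIMSEQ_power_zero) auto
    then have "eventually (\<lambda>n. r ^ n * (d - c) < e') sequentially"
      using e' by (intro order_tendstoD(2)) auto
    then obtain n where n: "r ^ n * (d - c) < e'"
      by (auto simp: eventually_sequentially)
    obtain I J where "straddles l u G I J" "gap I < e'" "gap J < e'"
      using straddles_small[OF G e' st, of n n] n by auto
    moreover obtain a c d b a' c' d' b' where IJ: "I = (a, c, d, b)" "J = (a', c', d', b')"
      by (metis prod_cases4)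
    ultimately have *: "(a, c, d, b) \<in> T" "(a', c', d', b') \<in> T" "l \<le> a" "b \<le> u" "l \<le> a'" "b' \<le> u"
       "G a a' \<le> 0" "0 \<le> G b b'" "d - c < e'" "d' - c' < e'"
      by (auto simp: straddles_def)
    have len: "b - a < e / 2" if "(a, c, d, b) \<in> T" "d - c < e'" for a c d b
    proof -
      have "b - a \<le> L * (d - c)" using length[OF that(1)] .
      also have "\<dots> \<le> (\<bar>L\<bar> + 1) * (d - c)"
        using node[OF that(1)] by (intro mult_right_mono) auto
      also have "\<dots> < (\<bar>L\<bar> + 1) * e'"
        using that(2) by (intro mult_strict_left_mono) auto
      also have "\<dots> = e / 2" by (simp add: e'_def field_simps)
      finally show ?thesis .
    qed
    have "dist (a, a') (b, b') \<le> dist a b + dist a' b'"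
      unfolding dist_Pair_Pair by (rule sqrt_sum_squares_le_sum) auto
    also have "\<dots> < e"
      using len[OF *(1,9)] len[OF *(2,10)] node[OF *(1)] node[OF *(2)] by (auto simp: dist_real_def)
    finally show ?thesis
      using * node[OF *(1)] node[OF *(2)]
      by (intro exI[of _ "(a, a')"] exI[of _ "(b, b')"]) auto
  qed
  then have "\<forall>n. \<exists>p q. p \<in> ?K \<and> q \<in> ?K \<and> dist p q < inverse (Suc n) \<and>
      (\<lambda>(x, y). G x y) p \<le> 0 \<and> 0 \<le> (\<lambda>(x, y). G x y) q"
    by simp
  then obtain p q where pq: "\<And>n. p n \<in> ?K" "\<And>n. q n \<in> ?K"
      "\<And>n. dist (p n) (q n) < inverse (Suc n)"
      "\<And>n. (\<lambda>(x, y). G x y) (p n) \<le> 0" "\<And>n. 0 \<le> (\<lambda>(x, y). G x y) (q n)"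
    by metis
  have "compact ?K"
    using compact_S by (intro compact_Times compact_Int_closed) auto
  then obtain z f where z: "z \<in> ?K" "strict_mono f" "(p \<circ> f) \<longlonglongrightarrow> z"
    using pq(1) unfolding compact_def by blast
  have "(\<lambda>n. dist (p n) (q n)) \<longlonglongrightarrow> 0"
    by (rule real_tendsto_sandwich[OF _ _ tendsto_const LIMSEQ_inverse_real_of_nat])
       (use pq(3) in \<open>auto intro!: always_eventually less_imp_le\<close>)
  then have "((\<lambda>n. dist (p n) (q n)) \<circ> f) \<longlonglongrightarrow> 0"
    using z(2) by (rule LIMSEQ_subseq_LIMSEQ)
  then have "(\<lambda>n. norm ((q \<circ> f) n - (p \<circ> f) n)) \<longlonglongrightarrow> 0"
    by (simp add: o_def dist_norm norm_minus_commute)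
  then have "(\<lambda>n. (q \<circ> f) n - (p \<circ> f) n) \<longlonglongrightarrow> 0"
    by (rule tendsto_norm_zero_cancel)
  from tendsto_add[OF z(3) this] have "(q \<circ> f) \<longlonglongrightarrow> z"
    by (simp add: o_def)
  have lim: "(\<lambda>n. (\<lambda>(x, y). G x y) (h n)) \<longlonglongrightarrow> (\<lambda>(x, y). G x y) z" if "h \<longlonglongrightarrow> z" for h
    using cont that by (intro continuous_on_tendsto_compose[OF cont]) auto
  have "(\<lambda>(x, y). G x y) z \<le> 0"
    using lim[OF z(3)] pq(4) by (intro LIMSEQ_le_const2[OF lim[OF z(3)]]) auto
  moreover have "0 \<le> (\<lambda>(x, y). G x y) z"
    using pq(5) by (intro LIMSEQ_le_const[OF lim[OF \<open>(q \<circ> f) \<longlonglongrightarrow> z\<close>]]) auto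
  ultimately show ?thesis
    using z(1) by (cases z) (auto intro!: bexI)
qed

end

section \<open>Continued fractions with digits from 1 to 10\<close>

text \<open>
  The largest and the smallest number whose regular continued fraction is infinite and has all its digits in
  \<open>{1..10}\<close>, with the expansions \<open>[10; 1, 10, 1, ...]\<close> and \<open>[1; 10, 1, 10, ...]\<close>. Hence
  \<open>cf_max = 10 + 1 / cf_min\<close> and \<open>cf_min = 1 + 1 / cf_max\<close>, which gives the closed form.
  The bound 10 on the digits is a convenient choice: it makes the Cantor set thick enough to
  work with \<open>k = 2\<close> in the tree of bridges below.
\<close>

definition cf_max :: real where "cf_max = 5 + sqrt 35"
definition cf_min :: real where "cf_min = cf_max / 10"

lemma cf_max_bounds: "109 / 10 < cf_max" "cf_max < 273 / 25"
proof -
  have "sqrt ((59 / 10)\<^sup>2) < sqrt 35" "sqrt 35 < sqrt ((148 / 25)\<^sup>2)"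
    by (intro real_sqrt_less_mono; simp add: power2_eq_square)+
  then show "109 / 10 < cf_max" "cf_max < 273 / 25"
    by (auto simp: cf_max_def)
qed

text \<open>
  Both reciprocals are affine functions of \<open>cf_max\<close>. The points \<open>l + 1 / cf_max\<close> and
  \<open>l + 1 / cf_min\<close>, which bound the gaps below, are therefore compared by linear arithmetic.
\<close>

lemma inverse_cf_max: "1 / cf_max = cf_max / 10 - 1"
  and inverse_cf_min: "1 / cf_min = cf_max - 10"
proof -
  have "cf_max * cf_max = 10 * cf_max + 10"
    by (simp add: cf_max_def algebra_simps)
  then show "1 / cf_max = cf_max / 10 - 1" "1 / cf_min = cf_max - 10"
    using cf_max_bounds by (auto simp: cf_min_def field_simps)
qed

text \<open>
  Level \<open>N\<close> prescribes \<open>N\<close> digits and leaves the rest to the hull of the Cantor set.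
\<close>

primrec cf_level :: "nat \<Rightarrow> real set" where
  "cf_level 0 = {cf_min..cf_max}"
| "cf_level (Suc N) = (\<Union>n\<in>{1..10::nat}. (\<lambda>s. real n + 1 / s) ` cf_level N)"

definition cf_set :: "real set" where
  "cf_set = (\<Inter>N. cf_level N)"

lemma cf_step_bounds:
  assumes "s \<in> {cf_min..cf_max}" "n \<in> {1..10::nat}"
  shows "real n + 1 / s \<in> {cf_min..cf_max}"
proof -
  have "0 < cf_min" using cf_max_bounds by (simp add: cf_min_def)
  then have "1 / s \<le> 1 / cf_min" "1 / cf_max \<le> 1 / s"
    using assms by (auto intro!: divide_left_mono)
  then show ?thesis
    using assms(2) unfolding inverse_cf_min inverse_cf_max by (auto simp: cf_min_def)
qed

lemma cf_level_subset: "cf_level N \<subseteq> {cf_min..cf_max}"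
proof (induction N)
  case (Suc N)
  then show ?case using cf_step_bounds by (force simp del: atLeastAtMost_iff)
qed simp

lemma cf_set_bounds: "s \<in> cf_set \<Longrightarrow> cf_min \<le> s \<and> s \<le> cf_max"
  using cf_level_subset by (fastforce simp: cf_set_def)

lemma cf_set_gt_1: "s \<in> cf_set \<Longrightarrow> 1 < s"
  using cf_set_bounds[of s] cf_max_bounds by (auto simp: cf_min_def)

lemma compact_cf_set: "compact cf_set"
proof -
  have "compact (cf_level N)" for N
  proof (induction N)
    case (Suc N)
    have "continuous_on (cf_level N) (\<lambda>s. real n + 1 / s)" for n :: nat
      using cf_level_subset[of N] cf_max_bounds
      by (intro continuous_intros) (auto simp: cf_min_def)
    then show ?case
      using Suc by (auto intro!: compact_continuous_image compact_UN)
  qed simp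
  then show ?thesis
    unfolding cf_set_def by (intro compact_Inter) auto
qed

lemma cf_set_Cons:
  assumes s: "s \<in> cf_set" and n: "n \<in> {1..10::nat}"
  shows "real n + 1 / s \<in> cf_set"
proof -
  have "real n + 1 / s \<in> cf_level N" for N
  proof (cases N)
    case 0
    then show ?thesis using cf_step_bounds[of s n] cf_set_bounds[OF s] n by simp
  next
    case (Suc N')
    then show ?thesis using s n by (auto simp del: atLeastAtMost_iff simp: cf_set_def)
  qed
  then show ?thesis by (simp add: cf_set_def)
qed

text \<open>
  The expansion of a point of a level may depend on the level. It does not, because the tail
  exceeds 1 and so the digit is the integer part.
\<close>

lemma cf_set_cases:
  assumes v: "v \<in> cf_set"
  shows "\<exists>n\<in>{1..10::nat}. \<exists>s\<in>cf_set. v = real n + 1 / s"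
proof -
  have gt1: "1 < s" if "s \<in> cf_level N" for s N
    using cf_level_subset[of N] that cf_max_bounds by (auto simp: cf_min_def)
  have "\<forall>N. \<exists>n\<in>{1..10::nat}. \<exists>s\<in>cf_level N. v = real n + 1 / s"
  proof
    fix N
    have "v \<in> cf_level (Suc N)" using v by (auto simp only: cf_set_def)
    then show "\<exists>n\<in>{1..10::nat}. \<exists>s\<in>cf_level N. v = real n + 1 / s" by auto
  qed
  then obtain n s where ns: "\<And>N. n N \<in> {1..10::nat}" "\<And>N. s N \<in> cf_level N"
      "\<And>N. v = real (n N) + 1 / s N"
    by metis
  have fl: "int (n N) = \<lfloor>v\<rfloor>" for N
  proof -
    have "0 < 1 / s N" "1 / s N < 1" using gt1[OF ns(2)[of N]] by auto
    then show ?thesis using ns(3)[of N] by (intro floor_unique[symmetric]) auto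
  qed
  have nn: "n N = n 0" for N using fl[of N] fl[of 0] by simp
  have "s N = s 0" for N
    using ns(3)[of N] ns(3)[of 0] nn[of N] gt1[OF ns(2)[of N]] gt1[OF ns(2)[of 0]]
    by (auto simp: field_simps)
  then have "s 0 \<in> cf_set" using ns(2) by (metis (no_types) INT_I cf_set_def)
  then show ?thesis using ns(1)[of 0] ns(3)[of 0] by blast
qed

lemma cf_extremes: "cf_min \<in> cf_set" "cf_max \<in> cf_set"
proof -
  have "cf_min = real 1 + 1 / cf_max" "cf_max = real 10 + 1 / cf_min"
    by (simp_all add: inverse_cf_max inverse_cf_min) (simp add: cf_min_def)
  note eqs = this(1,2)
  have "cf_min \<in> cf_level N \<and> cf_max \<in> cf_level N" for N
  proof (induction N)
    case 0
    then show ?case using cf_max_bounds by (auto simp: cf_min_def)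
  next
    case (Suc N)
    have one: "1 \<in> {1..10::nat}" "10 \<in> {1..10::nat}" by auto
    have "real 1 + 1 / cf_max \<in> cf_level (Suc N)" "real 10 + 1 / cf_min \<in> cf_level (Suc N)"
      unfolding cf_level.simps using Suc by (blast intro: UN_I[of 1] UN_I[of 10] imageI one)+
    then show ?case using eqs by metis
  qed
  then show "cf_min \<in> cf_set" "cf_max \<in> cf_set" by (auto simp: cf_set_def)
qed

section \<open>The tree of bridges of the Cantor set\<close>

text \<open>
  Two neighbouring integer translates of the Cantor set of the numbers \<open>1 / s\<close>; a single one of
  them has a hull shorter than 1.
\<close>

definition cf_window :: "nat \<Rightarrow> real set" where
  "cf_window R = (\<Union>n\<in>{R, Suc R}. (\<lambda>s. real n + 1 / s) ` cf_set)"

text \<open>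
  The map that prefixes digits to a continued fraction is a Moebius map; its coefficients are the
  numerators and denominators of the last two convergents. The conditions
  \<open>\<bar>p * q' - p' * q\<bar> = 1\<close> and \<open>0 \<le> q' \<le> q\<close> of \<open>branch\<close> control its distortion.
\<close>

definition moeb :: "real \<Rightarrow> real \<Rightarrow> real \<Rightarrow> real \<Rightarrow> real \<Rightarrow> real" where
  "moeb p p' q q' s = (p * s + p') / (q * s + q')"

definition branch :: "real set \<Rightarrow> real \<Rightarrow> real \<Rightarrow> real \<Rightarrow> real \<Rightarrow> bool" where
  "branch S p p' q q' \<longleftrightarrow> \<bar>p * q' - p' * q\<bar> = 1 \<and> 0 < q \<and> 0 \<le> q' \<and> q' \<le> q
     \<and> moeb p p' q q' ` cf_set \<subseteq> S"

text \<open>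
  The node of the tails whose first digit is at least \<open>l\<close>. Its gap separates those with first
  digit \<open>l\<close> from those with a larger one, so the ten digits are split off one at a time. A
  decreasing \<open>\<phi>\<close> lists the four points from right to left.
\<close>

definition node_at :: "(real \<Rightarrow> real) \<Rightarrow> nat \<Rightarrow> real \<times> real \<times> real \<times> real" where
  "node_at \<phi> l = (\<phi> (real l + 1 / cf_max), \<phi> (real l + 1 / cf_min),
      \<phi> (real (Suc l) + 1 / cf_max), \<phi> cf_max)"

definition branch_nodes :: "real set \<Rightarrow> (real \<times> real \<times> real \<times> real) set" where
  "branch_nodes S = {node_at (moeb p p' q q') l | p p' q q' l. branch S p p' q q' \<and> l \<in> {1..9}}"

lemma moeb_diff:
  assumes "branch S p p' q q'" "0 < x" "0 < y"
  shows "moeb p p' q q' x - moeb p p' q q' y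
           = (p * q' - p' * q) * ((x - y) / ((q * x + q') * (q * y + q')))"
proof -
  have "0 < q * x + q'" "0 < q * y + q'"
    using assms by (auto simp: branch_def intro!: add_pos_nonneg)
  then show ?thesis by (simp add: moeb_def divide_simps) (simp add: algebra_simps)
qed

lemma moeb_dist:
  assumes "branch S p p' q q'" "0 < x" "x \<le> y"
  shows "\<bar>moeb p p' q q' x - moeb p p' q q' y\<bar> = (y - x) / ((q * x + q') * (q * y + q'))"
proof -
  have "0 < q * x + q'" "0 < q * y + q'" "\<bar>p * q' - p' * q\<bar> = 1"
    using assms by (auto simp: branch_def intro!: add_pos_nonneg)
  then show ?thesis
    using assms by (subst moeb_diff[OF assms(1)]) (auto simp: abs_mult)
qed

lemma branch_Cons:
  assumes br: "branch S p p' q q'" and n: "n \<in> {1..10::nat}"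
  shows "branch S (p * n + p') p (q * n + q') q"
    and "0 < s \<Longrightarrow> moeb (p * n + p') p (q * n + q') q s = moeb p p' q q' (real n + 1 / s)"
proof -
  show eq: "moeb (p * n + p') p (q * n + q') q s = moeb p p' q q' (real n + 1 / s)" if "0 < s" for s
  proof -
    have "0 < real n" "0 < q" "0 \<le> q'" using br n by (auto simp: branch_def)
    then have "0 < q * (n + 1 / s) + q'" "0 < (q * n + q') * s + q"
      using that by (auto intro!: add_nonneg_pos add_pos_nonneg mult_pos_pos)
    then show ?thesis using that by (simp add: moeb_def divide_simps) (simp add: algebra_simps)
  qed
  have "q * 1 \<le> q * n" using br n by (intro mult_left_mono) (auto simp: branch_def)
  moreover have "moeb (p * n + p') p (q * n + q') q ` cf_set \<subseteq> S"
  proof safe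
    fix s assume s: "s \<in> cf_set"
    then show "moeb (p * n + p') p (q * n + q') q s \<in> S"
      using cf_set_Cons[OF s n] cf_set_gt_1[OF s] br by (subst eq) (auto simp: branch_def)
  qed
  moreover have "(p * n + p') * q - p * (q * n + q') = - (p * q' - p' * q)"
    by (simp add: algebra_simps)
  moreover have "\<bar>- (p * q' - p' * q)\<bar> = 1" "0 < q" "0 \<le> q'"
    using br by (auto simp: branch_def)
  moreover from calculation have "q \<le> q * n + q'" "0 < q * n + q'" by linarith+
  ultimately show "branch S (p * n + p') p (q * n + q') q"
    unfolding branch_def by simp
qed

lemma div_le_div_cross:
  fixes x y A B C :: real
  assumes "x * B \<le> y * A" "0 < A" "0 < B" "0 < C"
  shows "x / (A * C) \<le> y / (B * C)"
  using assms by (simp add: divide_simps)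

text \<open>
  By \<open>moeb_dist\<close> the map \<open>\<phi>\<close> scales the distance of two points \<open>x\<close>, \<open>y\<close> by the reciprocal of
  \<open>(q * x + q') * (q * y + q')\<close>. In the ratio of bridge to gap one of the two factors cancels,
  and the quotient of the remaining ones is at most the quotient of the points. Before the
  distortion the gap is about \<open>2 / 11\<close>, the left bridge about \<open>9 / 11\<close> and the right bridge at
  least that. The constant 400 is far from sharp.
\<close>

lemma node_bridges:
  assumes br: "branch S p p' q q'" and l: "l \<in> {1..9}" and nd: "node_at (moeb p p' q q') l = (a, c, d, b)"
  shows "2 * \<bar>d - c\<bar> \<le> \<bar>c - a\<bar>" "2 * \<bar>d - c\<bar> \<le> \<bar>b - d\<bar>" "\<bar>b - a\<bar> \<le> 400 * \<bar>d - c\<bar>"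
    "a < c \<and> c < d \<and> d < b \<or> b < d \<and> d < c \<and> c < a"
    "a \<in> S" "b \<in> S"
proof -
  define A where "A = real l + cf_max / 10 - 1"
  define C where "C = real l + cf_max - 10"
  define D where "D = real l + cf_max / 10"
  define B where "B = cf_max"
  note defs = A_def B_def C_def D_def
  have pts: "a = moeb p p' q q' A" "c = moeb p p' q q' C" "d = moeb p p' q q' D" "b = moeb p p' q q' B"
    using nd by (simp_all add: node_at_def inverse_cf_max inverse_cf_min defs algebra_simps)
  have lr: "1 \<le> real l" "real l \<le> 9" using l by auto
  have ord: "0 < A" "A < C" "C < D" "D < B"
    using lr cf_max_bounds by (auto simp: defs)
  define QA QB QC QD where "QA = q * A + q'" and "QB = q * B + q'" and "QC = q * C + q'" and "QD = q * D + q'"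
  note Qdefs = QA_def QB_def QC_def QD_def
  have q: "0 < q" "0 \<le> q'" "q' \<le> q" using br by (auto simp: branch_def)
  have "0 < q * A" using q ord by simp
  then have Qord: "0 < QA" "QA < QC" "QC < QD" "QD < QB"
    using q ord by (auto simp: Qdefs intro: add_pos_nonneg)
  have dist: "\<bar>c - a\<bar> = (C - A) / (QA * QC)" "\<bar>d - c\<bar> = (D - C) / (QC * QD)"
     "\<bar>b - d\<bar> = (B - D) / (QD * QB)" "\<bar>b - a\<bar> = (B - A) / (QA * QB)"
    using moeb_dist[OF br, of A C] moeb_dist[OF br, of C D] moeb_dist[OF br, of D B] moeb_dist[OF br, of A B] ord
    by (auto simp: pts Qdefs abs_minus_commute)
  have "2 * (D - C) * QA \<le> (C - A) * QA"
    using Qord cf_max_bounds by (intro mult_right_mono) (auto simp: defs)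
  also have "\<dots> \<le> (C - A) * QD"
    using Qord ord by (intro mult_left_mono) auto
  finally have "2 * (D - C) / (QD * QC) \<le> (C - A) / (QA * QC)"
    using Qord by (intro div_le_div_cross) auto
  then show "2 * \<bar>d - c\<bar> \<le> \<bar>c - a\<bar>" by (simp add: dist mult_ac)
  \<comment> \<open>The length of the right bridge times \<open>C\<close> is concave in \<open>l\<close>, hence bounded below by its
    values at 1 and 9.\<close>
  have "(real l - 1) * (9 - real l) \<ge> 0" using lr by simp
  then have "(19 / 50) * (273 / 25) \<le> (981 / 100 - real l) * (real l + 9 / 10)"
    using lr by (simp add: algebra_simps)
  moreover have "2 * (D - C) * B \<le> (19 / 50) * (273 / 25)" 
    using lr cf_max_bounds by (intro mult_mono) (auto simp: defs)
  moreover have "(981 / 100 - real l) * (real l + 9 / 10) \<le> (B - D) * C"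
    using lr cf_max_bounds by (intro mult_mono) (auto simp: defs)
  ultimately have "2 * (D - C) * B \<le> (B - D) * C \<and> 2 * (D - C) \<le> B - D"
    using lr cf_max_bounds by (auto simp: defs)
  then have "q * (2 * (D - C) * B) + q' * (2 * (D - C)) \<le> q * ((B - D) * C) + q' * (B - D)"
    using q by (intro add_mono mult_left_mono) auto
  then have "2 * (D - C) * QB \<le> (B - D) * QC"
    by (simp add: Qdefs algebra_simps)
  then have "2 * (D - C) / (QC * QD) \<le> (B - D) / (QB * QD)"
    using Qord by (intro div_le_div_cross) auto
  then show "2 * \<bar>d - c\<bar> \<le> \<bar>b - d\<bar>" by (simp add: dist mult_ac)
  have "q * D \<le> q * (3 * A)"
    using q lr cf_max_bounds by (intro mult_left_mono) (auto simp: defs)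
  also have "\<dots> = 3 * (q * A)" by simp
  finally have "q * D \<le> 3 * (q * A)" .
  then have QD3: "QD \<le> 3 * QA" using q unfolding Qdefs distrib_left by linarith
  have "(B - A) * (QC * QD) \<le> 11 * (QB * (3 * QA))"
    using Qord QD3 ord lr cf_max_bounds by (intro mult_mono) (auto simp: defs)
  also have "\<dots> \<le> (400 * (D - C)) * (QB * QA)"
    using Qord cf_max_bounds by (auto simp: defs)
  finally have "(B - A) / (QA * QB) \<le> 400 * (D - C) / (QC * QD)"
    using Qord by (simp add: divide_simps mult_ac)
  then show "\<bar>b - a\<bar> \<le> 400 * \<bar>d - c\<bar>" by (simp add: dist)
  have pos: "0 < (C - A) / (QA * QC)" "0 < (D - C) / (QC * QD)" "0 < (B - D) / (QD * QB)"
    using Qord ord by auto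
  have "c - a = (p * q' - p' * q) * ((C - A) / (QA * QC))"
    "d - c = (p * q' - p' * q) * ((D - C) / (QC * QD))"
    "b - d = (p * q' - p' * q) * ((B - D) / (QD * QB))"
    using ord by (simp_all add: pts moeb_diff[OF br] Qdefs mult_ac)
  moreover have "p * q' - p' * q = 1 \<or> p * q' - p' * q = - 1"
    using br by (auto simp: branch_def abs_if split: if_splits)
  ultimately show "a < c \<and> c < d \<and> d < b \<or> b < d \<and> d < c \<and> c < a"
    using pos by (elim disjE) (simp only: mult_1_left mult_minus1, linarith)+
  have "real l + 1 / cf_max \<in> cf_set" using l by (intro cf_set_Cons cf_extremes) auto
  then show "a \<in> S" using br nd by (auto simp: branch_def node_at_def)
  show "b \<in> S" using br nd cf_extremes by (auto simp: branch_def node_at_def)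
qed

lemma branch_gap:
  assumes "branch S p p' q q'" "node_at (moeb p p' q q') l = (a, c, d, b)"
  shows "\<bar>d - c\<bar> = (10 - 9 / 10 * cf_max) /
     ((q * (real l + cf_max - 10) + q') * (q * (real l + cf_max / 10) + q'))"
proof -
  have pts: "c = moeb p p' q q' (real l + cf_max - 10)" "d = moeb p p' q q' (real l + cf_max / 10)"
    using assms(2) by (simp_all add: node_at_def inverse_cf_max inverse_cf_min algebra_simps)
  have "0 < real l + cf_max - 10" "real l + cf_max - 10 \<le> real l + cf_max / 10" 
    using cf_max_bounds by linarith+
  from moeb_dist[OF assms(1) this] show ?thesis by (simp add: pts abs_minus_commute)
qed

lemma node_at_Cons:
  assumes br: "branch S p p' q q'" and n: "n \<in> {1..10::nat}" 
  shows "\<exists>c' d'. node_at (moeb (p * n + p') p (q * n + q') q) 1 =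
    (moeb p p' q q' (real n + 1 / cf_min), d', c', moeb p p' q q' (real n + 1 / cf_max))"
proof -
  have "real 1 + 1 / cf_max = cf_min" by (simp add: inverse_cf_max cf_min_def)
  then show ?thesis
    using branch_Cons(2)[OF br n, of cf_min] branch_Cons(2)[OF br n, of cf_max] cf_max_bounds
    by (simp add: node_at_def) (simp add: cf_min_def)
qed

text \<open>
  Fixing the digit \<open>n\<close> shrinks the gap: the map \<open>s \<mapsto> n + 1 / s\<close> contracts the first gap, which
  is close to 2, by about 4, and the distortion gives back a factor of about 2 at most.
\<close>

lemma gap_Cons:
  assumes br: "branch S p p' q q'" and l: "1 \<le> l" "l \<le> n" and n: "n \<in> {1..10::nat}" 
    and nd: "node_at (moeb p p' q q') l = (a, c, d, b)"
    and nd': "node_at (moeb (p * n + p') p (q * n + q') q) 1 = (a', c', d', b')"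
  shows "\<bar>d' - c'\<bar> \<le> 19 / 20 * \<bar>d - c\<bar>"
proof -
  define g where "g = 10 - 9 / 10 * cf_max"
  define C where "C = real l + cf_max - 10"
  define D where "D = real l + cf_max / 10"
  define C1 where "C1 = cf_max - 9"
  define D1 where "D1 = 1 + cf_max / 10"
  have lr: "1 \<le> real l" "real l \<le> real n" "1 \<le> real n" using l by auto
  have q: "0 < q" "0 \<le> q'" "q' \<le> q" using br by (auto simp: branch_def)
  have g: "0 < g" using cf_max_bounds by (simp add: g_def)
  have g1: "\<bar>d - c\<bar> = g / ((q * C + q') * (q * D + q'))"
    using branch_gap[OF br nd] by (simp add: C_def D_def g_def algebra_simps)
  have g2: "\<bar>d' - c'\<bar> = g / (((q * n + q') * C1 + q) * ((q * n + q') * D1 + q))"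
    using branch_gap[OF branch_Cons(1)[OF br n] nd'] by (simp add: C1_def D1_def g_def algebra_simps)
  have 0: "0 < q * C" "0 < q * D" using q lr cf_max_bounds by (auto simp: C_def D_def)
  have qn: "q * 1 \<le> q * l" "q * l \<le> q * n" "q * real l * (19 / 10) \<le> q * n * C1" "q * l * (209 / 100) \<le> q * n * D1"
    using q lr cf_max_bounds by (auto intro!: mult_left_mono mult_mono simp: C1_def D1_def)
  have "19 / 10 \<le> C1" "209 / 100 \<le> D1"
    using cf_max_bounds by (auto simp: C1_def D1_def)
  then have "q' * (19 / 10) \<le> q' * C1" "q' * (209 / 100) \<le> q' * D1"
    using q by (intro mult_left_mono; simp)+
  moreover have "q * C \<le> q * (l + 23 / 25)" "q * D \<le> q * (l + 11 / 10)"
    using q cf_max_bounds by (auto intro!: mult_left_mono simp: C_def D_def)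
  ultimately have "(7 / 5) * (q * C + q') \<le> (q * n + q') * C1 + q" "(7 / 5) * (q * D + q') \<le> (q * n + q') * D1 + q"
    using qn q unfolding ring_distribs by linarith+
  then have "(7 / 5) * (q * C + q') * ((7 / 5) * (q * D + q')) \<le> ((q * n + q') * C1 + q) * ((q * n + q') * D1 + q)"
    using 0 q by (intro mult_mono) auto
  also have "(7 / 5) * (q * C + q') * ((7 / 5) * (q * D + q')) = 49 / 25 * ((q * C + q') * (q * D + q'))"
    by (simp add: algebra_simps)
  finally have "(q * C + q') * (q * D + q') \<le> 19 / 20 * (((q * n + q') * C1 + q) * ((q * n + q') * D1 + q))"
    using 0 q mult_pos_pos[of "q * C + q'" "q * D + q'"] by linarith
  moreover have "0 < (q * C + q') * (q * D + q')"
    using 0 q by (intro mult_pos_pos) auto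
  ultimately have "g / (((q * n + q') * C1 + q) * ((q * n + q') * D1 + q))
       \<le> 19 / 20 * (g / ((q * C + q') * (q * D + q')))"
    using g by (simp add: divide_simps)
  then show ?thesis by (simp add: g1 g2)
qed

text \<open>
  The gaps between successive digits have equal length before the distortion, and the
  denominators \<open>q * x + q'\<close> grow by \<open>q\<close>. At the left end of the gap the denominator is at most
  \<open>19 * q\<close>, hence the factor \<open>19 / 20\<close>.
\<close>

lemma gap_Suc:
  assumes br: "branch S p p' q q'" and l: "l \<in> {1..8}"
    and nd: "node_at (moeb p p' q q') l = (a, c, d, b)"
    and nd': "node_at (moeb p p' q q') (Suc l) = (a', c', d', b')"
  shows "\<bar>d' - c'\<bar> \<le> 19 / 20 * \<bar>d - c\<bar>"
proof -
  define g where "g = 10 - 9 / 10 * cf_max"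
  define QC where "QC = q * (real l + cf_max - 10) + q'"
  define QD where "QD = q * (real l + cf_max / 10) + q'"
  have lr: "1 \<le> real l" "real l \<le> 8" using l by auto
  have q: "0 < q" "0 \<le> q'" "q' \<le> q" using br by (auto simp: branch_def)
  have g: "0 < g" using cf_max_bounds by (simp add: g_def)
  have g1: "\<bar>d - c\<bar> = g / (QC * QD)"
    using branch_gap[OF br nd] by (simp add: QC_def QD_def g_def algebra_simps)
  have g2: "\<bar>d' - c'\<bar> = g / ((QC + q) * (QD + q))"
    using branch_gap[OF br nd'] by (simp add: QC_def QD_def g_def algebra_simps)
  have QC: "0 < q * (real l + cf_max - 10)" "q * (real l + cf_max - 10) \<le> q * 18"
   and QD: "0 < q * (real l + cf_max / 10)" 
    using q lr cf_max_bounds by (auto intro!: mult_left_mono mult_pos_pos)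
  have "QC * QD \<le> (19 / 20 * (QC + q)) * (QD + q)"
    using q QC QD by (intro mult_mono) (auto simp: QC_def QD_def)
  moreover have "0 < QC * QD" "0 < (QC + q) * (QD + q)"
    using QC QD q by (auto intro!: mult_pos_pos add_pos_nonneg simp: QC_def QD_def)
  ultimately have "g / ((QC + q) * (QD + q)) \<le> 19 / 20 * (g / (QC * QD))"
    using g by (simp add: divide_simps) (simp add: algebra_simps)
  then show ?thesis by (simp add: g1 g2)
qed

text \<open>
  Prefixing one more digit reverses the orientation, which is why the child appears backwards.
\<close>

lemma branch_nodes_left:
  assumes "(a, c, d, b) \<in> branch_nodes S"
  shows "\<exists>c' d'. (c, d', c', a) \<in> branch_nodes S \<and> \<bar>d' - c'\<bar> \<le> 19 / 20 * \<bar>d - c\<bar>"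
proof -
  obtain p p' q q' l where br: "branch S p p' q q'" and l: "l \<in> {1..9}"
      and nd: "node_at (moeb p p' q q') l = (a, c, d, b)"
    using assms by (fastforce simp: branch_nodes_def)
  have l': "l \<in> {1..10}" using l by auto
  obtain c' d' where 1: "node_at (moeb (p * l + p') p (q * l + q') q) 1 = (c, d', c', a)"
    using node_at_Cons[OF br l'] nd by (auto simp: node_at_def)
  then have "(c, d', c', a) \<in> branch_nodes S"
    unfolding branch_nodes_def using branch_Cons(1)[OF br l'] by force
  then show ?thesis
    using gap_Cons[OF br _ order_refl l' nd 1] l by (auto simp: abs_minus_commute)
qed

lemma branch_nodes_right:
  assumes "(a, c, d, b) \<in> branch_nodes S"
  shows "\<exists>c' d'. ((d, c', d', b) \<in> branch_nodes S \<or> (b, d', c', d) \<in> branch_nodes S)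
           \<and> \<bar>d' - c'\<bar> \<le> 19 / 20 * \<bar>d - c\<bar>"
proof -
  obtain p p' q q' l where br: "branch S p p' q q'" and l: "l \<in> {1..9}"
      and nd: "node_at (moeb p p' q q') l = (a, c, d, b)"
    using assms by (fastforce simp: branch_nodes_def)
  show ?thesis
  proof (cases "l = 9")
    case True
    \<comment> \<open>Only the digit 10 is left, so the right child prefixes it.\<close>
    have "cf_max = real 10 + 1 / cf_min" by (simp add: inverse_cf_min)
    then have "b = moeb p p' q q' (real 10 + 1 / cf_min)" "d = moeb p p' q q' (real 10 + 1 / cf_max)"
      using nd True by (auto simp: node_at_def)
    moreover have ten: "10 \<in> {1..10::nat}" by simp
    ultimately obtain c' d' where 1: "node_at (moeb (p * real 10 + p') p (q * real 10 + q') q) 1 = (b, d', c', d)"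
      using node_at_Cons[OF br ten] by auto
    then have "(b, d', c', d) \<in> branch_nodes S"
      unfolding branch_nodes_def using branch_Cons(1)[OF br ten] by force
    then show ?thesis
      using gap_Cons[OF br _ _ ten nd 1] l by (auto simp: abs_minus_commute)
  next
    case False
    then have l': "l \<in> {1..8}" using l by auto
    obtain c' d' where 1: "node_at (moeb p p' q q') (Suc l) = (d, c', d', b)"
      using nd by (auto simp: node_at_def)
    then have "(d, c', d', b) \<in> branch_nodes S"
      unfolding branch_nodes_def using br l' by force
    then show ?thesis
      using gap_Suc[OF br l' nd 1] by auto
  qed
qed

definition unoriented_nodes :: "real set \<Rightarrow> (real \<times> real \<times> real \<times> real) set" where
  "unoriented_nodes S = {(a, c, d, b). (a, c, d, b) \<in> branch_nodes S \<or> (b, d, c, a) \<in> branch_nodes S}"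

lemma unoriented_nodes_sym: "(a, c, d, b) \<in> unoriented_nodes S \<longleftrightarrow> (b, d, c, a) \<in> unoriented_nodes S"
  by (auto simp: unoriented_nodes_def)

text \<open>
  All estimates are invariant under reversal, so they need to be known for one orientation only.
\<close>

lemma unoriented_node:
  assumes "(a, c, d, b) \<in> unoriented_nodes S"
  shows "2 * \<bar>d - c\<bar> \<le> \<bar>c - a\<bar> \<and> 2 * \<bar>d - c\<bar> \<le> \<bar>b - d\<bar> \<and> \<bar>b - a\<bar> \<le> 400 * \<bar>d - c\<bar>
    \<and> (a < c \<and> c < d \<and> d < b \<or> b < d \<and> d < c \<and> c < a) \<and> a \<in> S \<and> b \<in> S
    \<and> (\<exists>c' d'. (a, c', d', c) \<in> unoriented_nodes S \<and> \<bar>d' - c'\<bar> \<le> 19 / 20 * \<bar>d - c\<bar>)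
    \<and> (\<exists>c' d'. (d, c', d', b) \<in> unoriented_nodes S \<and> \<bar>d' - c'\<bar> \<le> 19 / 20 * \<bar>d - c\<bar>)"
    (is "?P a c d b")
proof -
  have P: "?P a c d b" if N: "(a, c, d, b) \<in> branch_nodes S" for a b c d
  proof -
    obtain p p' q q' l where "branch S p p' q q'" "l \<in> {1..9}"
      "node_at (moeb p p' q q') l = (a, c, d, b)"
      using N by (fastforce simp: branch_nodes_def)
    note bridges = node_bridges[OF this]
    show ?thesis
      using branch_nodes_left[OF N] branch_nodes_right[OF N] bridges
      by (intro conjI) (auto simp: unoriented_nodes_def)
  qed
  have "?P a c d b" if *: "?P b d c a"
  proof -
    obtain c1 d1 c2 d2 where 1: "(b, c1, d1, d) \<in> unoriented_nodes S" "\<bar>d1 - c1\<bar> \<le> 19 / 20 * \<bar>c - d\<bar>"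
        "(c, c2, d2, a) \<in> unoriented_nodes S" "\<bar>d2 - c2\<bar> \<le> 19 / 20 * \<bar>c - d\<bar>"
      using * by blast
    have "(d, d1, c1, b) \<in> unoriented_nodes S" "\<bar>c1 - d1\<bar> \<le> 19 / 20 * \<bar>d - c\<bar>"
        "(a, d2, c2, c) \<in> unoriented_nodes S" "\<bar>c2 - d2\<bar> \<le> 19 / 20 * \<bar>d - c\<bar>"
      using 1 unoriented_nodes_sym by (auto simp: abs_minus_commute)
    then have "\<exists>c' d'. (a, c', d', c) \<in> unoriented_nodes S \<and> \<bar>d' - c'\<bar> \<le> 19 / 20 * \<bar>d - c\<bar>"
       "\<exists>c' d'. (d, c', d', b) \<in> unoriented_nodes S \<and> \<bar>d' - c'\<bar> \<le> 19 / 20 * \<bar>d - c\<bar>"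
      by blast+
    moreover have "2 * \<bar>d - c\<bar> \<le> \<bar>c - a\<bar> \<and> 2 * \<bar>d - c\<bar> \<le> \<bar>b - d\<bar> \<and> \<bar>b - a\<bar> \<le> 400 * \<bar>d - c\<bar>
        \<and> (a < c \<and> c < d \<and> d < b \<or> b < d \<and> d < c \<and> c < a) \<and> a \<in> S \<and> b \<in> S"
      using * by (elim conjE) (auto simp: abs_minus_commute)
    ultimately show ?thesis by blast
  qed
  then show ?thesis using assms P unfolding unoriented_nodes_def by blast
qed

text \<open>
  The root joins the two copies of the Cantor set in the window; its gap is the one between
  the copies, and its length exceeds 1.
\<close>

definition cf_tree :: "nat \<Rightarrow> (real \<times> real \<times> real \<times> real) set" where
  "cf_tree R = insert
     (real R + 1 / cf_max, real R + 1 / cf_min, real (Suc R) + 1 / cf_max, real (Suc R) + 1 / cf_min)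
     {(a, c, d, b). (a, c, d, b) \<in> unoriented_nodes (cf_window R) \<and> a < b}"

lemma cf_window_child:
  assumes n: "n = R \<or> n = Suc R"
  shows "\<exists>c' d'. (real n + 1 / cf_max, c', d', real n + 1 / cf_min) \<in> cf_tree R
       \<and> d' - c' \<le> 19 / 20 * (10 - 9 / 10 * cf_max)"
proof -
  have m: "moeb (real n) 1 1 0 s = real n + 1 / s" if "0 < s" for s
    using that by (simp add: moeb_def field_simps)
  have br: "branch (cf_window R) (real n) 1 1 0"
    unfolding branch_def
  proof (safe)
    fix s assume s: "s \<in> cf_set"
    then have "0 < s" using cf_set_gt_1[of s] by simp
    then show "moeb (real n) 1 1 0 s \<in> cf_window R"
      using s n m by (auto simp: cf_window_def)
  qed auto
  have "1 + 1 / cf_max = cf_min" by (simp add: inverse_cf_max cf_min_def)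
  moreover have "0 < cf_min" "0 < cf_max" using cf_max_bounds by (auto simp: cf_min_def)
  ultimately obtain c d where nd: "node_at (moeb (real n) 1 1 0) 1 = (real n + 1 / cf_min, d, c, real n + 1 / cf_max)"
    using m by (simp add: node_at_def)
  have "(real n + 1 / cf_min, d, c, real n + 1 / cf_max) \<in> branch_nodes (cf_window R)"
    unfolding branch_nodes_def using br nd by force
  then have "(real n + 1 / cf_max, c, d, real n + 1 / cf_min) \<in> cf_tree R"
    using cf_max_bounds by (auto simp: cf_tree_def unoriented_nodes_def inverse_cf_min inverse_cf_max)
  moreover have "\<bar>c - d\<bar> \<le> 19 / 20 * (10 - 9 / 10 * cf_max)"
  proof -
    have "1 * (20 / 19) \<le> (cf_max - 9) * (1 + cf_max / 10)"
      using cf_max_bounds by (intro mult_mono) auto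
    then have "(10 - 9 / 10 * cf_max) / ((cf_max - 9) * (1 + cf_max / 10)) \<le> (10 - 9 / 10 * cf_max) / (1 * (20 / 19))"
      using cf_max_bounds by (intro divide_left_mono) auto
    then show ?thesis
      using branch_gap[OF br nd] by simp
  qed
  ultimately show ?thesis by (intro exI[of _ c] exI[of _ d] conjI) linarith+
qed

interpretation cf_tree: bridge_tree "cf_window R" "cf_tree R" 2 "19 / 20" 400 for R
proof
  have "continuous_on cf_set (\<lambda>s. real n + 1 / s)" for n
    using cf_set_gt_1 by (intro continuous_intros) force
  then show "compact (cf_window R)"
    unfolding cf_window_def by (intro compact_UN compact_continuous_image compact_cf_set) auto
  have root_mem: "real R + 1 / cf_max \<in> cf_window R" "real (Suc R) + 1 / cf_min \<in> cf_window R"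
    using cf_extremes by (auto simp: cf_window_def)
  fix a c d b
  assume "(a, c, d, b) \<in> cf_tree R"
  then consider (root) "a = real R + 1 / cf_max" "c = real R + 1 / cf_min"
      "d = real (Suc R) + 1 / cf_max" "b = real (Suc R) + 1 / cf_min"
    | (node) "(a, c, d, b) \<in> unoriented_nodes (cf_window R)" "a < b"
    by (auto simp: cf_tree_def)
  note cases = this
  show "a < c \<and> c < d \<and> d < b \<and> a \<in> cf_window R \<and> b \<in> cf_window R"
    using cases
  proof cases
    case root
    then show ?thesis
      using root_mem cf_max_bounds by (auto simp: inverse_cf_min inverse_cf_max)
  qed (use unoriented_node in force)
  show "2 * (d - c) \<le> c - a \<and> 2 * (d - c) \<le> b - d"
    using cases
  proof cases
    case root
    then show ?thesis
      using cf_max_bounds by (auto simp: inverse_cf_min inverse_cf_max)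
  qed (use unoriented_node in force)
  show "b - a \<le> 400 * (d - c)"
    using cases
  proof cases
    case root
    then show ?thesis
      using cf_max_bounds by (auto simp: inverse_cf_min inverse_cf_max)
  qed (use unoriented_node in force)
  show "\<exists>c' d'. (a, c', d', c) \<in> cf_tree R \<and> d' - c' \<le> 19 / 20 * (d - c)"
    using cases
  proof cases
    case root
    then have "d - c = 10 - 9 / 10 * cf_max" by (simp add: inverse_cf_min inverse_cf_max)
    then show ?thesis using cf_window_child[of R R] root by simp
  next
    case node
    from unoriented_node[OF node(1)] node(2) show ?thesis
      unfolding cf_tree_def by (force simp: abs_if split: if_splits)
  qed
  show "\<exists>c' d'. (d, c', d', b) \<in> cf_tree R \<and> d' - c' \<le> 19 / 20 * (d - c)"
    using cases
  proof cases
    case root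
    then have "d - c = 10 - 9 / 10 * cf_max" by (simp add: inverse_cf_min inverse_cf_max)
    then show ?thesis using cf_window_child[of "Suc R" R] root by simp
  next
    case node
    from unoriented_node[OF node(1)] node(2) show ?thesis
      unfolding cf_tree_def by (force simp: abs_if split: if_splits)
  qed
qed auto

section \<open>Empty boxes of a lattice\<close>

definition empty_box :: "(real \<times> real) set \<Rightarrow> real \<Rightarrow> real \<Rightarrow> bool" where
  "empty_box L X Y \<longleftrightarrow> (\<forall>(x, y)\<in>L. 0 \<le> x \<longrightarrow> x \<le> X \<longrightarrow> 0 \<le> y \<longrightarrow> y \<le> Y \<longrightarrow> x = 0 \<and> y = 0)"

lemma empty_boxD:
  "empty_box L X Y \<Longrightarrow> (x, y) \<in> L \<Longrightarrow> 0 < x \<Longrightarrow> 0 \<le> y \<Longrightarrow> x \<le> X \<Longrightarrow> Y < y"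
  by (force simp: empty_box_def)

text \<open>
  The lattice is followed along a continued fraction. Write \<open>P = (x, y)\<close> and \<open>D = (dx, - dy)\<close>
  with \<open>y = V * dy\<close> and \<open>V = n + 1 / (k + 1 / W)\<close>. Then \<open>P' = P + n D\<close> and \<open>D' = D + k P'\<close> form the
  same configuration with \<open>W\<close> in place of \<open>V\<close>. A box of width between \<open>x\<close> and \<open>x'\<close> must be
  lower than \<open>P\<close>, and \<open>x' y \<le> V\<close> because the determinant is 1. Wider boxes are passed on to \<open>P'\<close>;
  since the height of \<open>P\<close> at least halves in each step while \<open>x' y \<ge> 1\<close>, this stops.
\<close>

lemma tail_box_bound:
  assumes L: "\<And>x y x' y' n. (x, y) \<in> L \<Longrightarrow> (x', y') \<in> L \<Longrightarrow> (x + real n * x', y + real n * y') \<in> L"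
    and box: "empty_box L X Y" and Y: "0 < Y"
    and V: "V \<in> cf_set" and P: "(x, V * dy) \<in> L" and D: "(dx, - dy) \<in> L"
    and pos: "0 < x" "0 < dx" "0 < dy" and det: "x * dy + dx * (V * dy) = 1"
    and X: "x \<le> X"
  shows "X * Y \<le> cf_max"
proof -
  obtain N where N: "X * (V * dy) < 2 ^ N"
    using real_arch_pow[of 2 "X * (V * dy)"] by auto
  from V P D pos det X N show ?thesis
  proof (induction N arbitrary: V x dx dy rule: less_induct)
    case (less N)
    obtain n s where n: "n \<in> {1..10::nat}" and s: "s \<in> cf_set" and V: "V = real n + 1 / s"
      using cf_set_cases[OF less.prems(1)] by blast
    obtain k W where k: "k \<in> {1..10::nat}" and W: "W \<in> cf_set" and sk: "s = real k + 1 / W"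
      using cf_set_cases[OF s] by blast
    have s1: "1 < s" and W1: "1 < W" and V1: "1 < V" and n1: "1 \<le> real n"
      using cf_set_gt_1 s W less.prems(1) n by auto
    have pos: "0 < x" "0 < dx" "0 < dy" using less.prems by auto
    define x' where "x' = x + real n * dx"
    have area: "x' * (V * dy) \<le> V" and det': "1 \<le> x' * (V * dy)"
    proof -
      have eq: "x' * (V * dy) = V * (x * dy) + real n * (dx * (V * dy))"
        by (simp add: x'_def algebra_simps)
      have "V * (x * dy) + real n * (dx * (V * dy)) \<le> V * (x * dy) + V * (dx * (V * dy))"
        using V s1 pos V1 by (intro add_left_mono mult_right_mono) auto
      also have "\<dots> = V" using less.prems(7) by (metis distrib_left mult.right_neutral)
      finally show "x' * (V * dy) \<le> V" by (simp add: eq)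
      have "1 * (x * dy) + 1 * (dx * (V * dy)) \<le> V * (x * dy) + real n * (dx * (V * dy))"
        using V1 n1 pos by (intro add_mono mult_right_mono) auto
      then show "1 \<le> x' * (V * dy)" using less.prems(7) eq by simp
    qed
    \<comment> \<open>The inequality \<open>1 \<le> x' * (V * dy)\<close> excludes \<open>x' \<le> X\<close> once \<open>N = 0\<close>.\<close>
    show ?case
    proof (cases "X < x'")
      case True
      have "Y < V * dy"
        using empty_boxD[OF box less.prems(2)] pos V1 less.prems(8) by simp
      then have "X * Y \<le> x' * (V * dy)"
        using True Y pos less.prems(8) by (intro mult_mono) auto
      then show ?thesis using area cf_set_bounds[OF less.prems(1)] by simp
    next
      case False
      have "1 \<le> X * (V * dy)"
      proof -
        have "x' * (V * dy) \<le> X * (V * dy)" using False pos V1 by (intro mult_right_mono) auto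
        then show ?thesis using det' by simp
      qed
      with less.prems(9) have "N \<noteq> 0" by (intro notI) simp
      then obtain N' where N: "N = Suc N'" by (cases N) auto
      define dy' where "dy' = dy / (s * W)"
      have y': "W * dy' = dy / s" "V * dy + real n * - dy = W * dy'"
        using W1 s1 by (auto simp: dy'_def V algebra_simps)
      have "s * W = real k * W + 1" using W1 by (simp add: sk field_simps)
      moreover have "dy' * (s * W) = dy" using s1 W1 by (simp add: dy'_def)
      ultimately have dy: "dy = dy' + real k * (W * dy')" by (simp add: algebra_simps)
      have P': "(x', W * dy') \<in> L"
        using L[OF less.prems(2,3), of n] y' by (simp add: x'_def)
      have "- dy + real k * (W * dy') = - dy'" using dy by simp
      then have D': "(dx + real k * x', - dy') \<in> L"
        using L[OF less.prems(3) P', of k] by simp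
      have pos': "0 < x'" "0 < dy'" using pos n1 s1 W1 by (auto simp: x'_def dy'_def add_pos_nonneg)
      then have pos'': "0 < dx + real k * x'" using pos by (simp add: add_pos_nonneg)
      have "x' * dy' + (dx + real k * x') * (W * dy') = x' * (dy' + real k * (W * dy')) + dx * (W * dy')"
        by (simp add: algebra_simps)
      also have "\<dots> = x' * dy + dx * (V * dy + real n * - dy)" by (simp only: dy[symmetric] y'(2))
      also have "\<dots> = x * dy + dx * (V * dy)" by (simp add: x'_def algebra_simps)
      finally have det'': "x' * dy' + (dx + real k * x') * (W * dy') = 1"
        using less.prems(7) by simp
      have "1 / s < 1" using s1 by simp
      then have "2 * (1 / s) \<le> V" using V n1 by linarith
      then have "2 * (1 / s) * dy \<le> V * dy" using pos by (intro mult_right_mono) auto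
      then have "X * (2 * (W * dy')) \<le> X * (V * dy)"
        using pos less.prems(8) by (intro mult_left_mono) (auto simp: y'(1))
      then have "X * (W * dy') < 2 ^ N'" using less.prems(9) by (simp add: N)
      then show ?thesis
        using less.IH[of N', OF _ W P' D' pos'(1) pos'' pos'(2) det''] False N by simp
    qed
  qed
qed

definition pair_lattice :: "real \<Rightarrow> real \<Rightarrow> real \<Rightarrow> real \<Rightarrow> (real \<times> real) set" where
  "pair_lattice a b c e = {(of_int m * a + of_int n * c, of_int m * b + of_int n * e) | m n :: int. True}"

text \<open>
  The vectors \<open>P = (U - 1, V d)\<close> and \<open>D = (1, - d)\<close> with \<open>d = 1 / (U + V - 1)\<close>. The points \<open>P + i D\<close>
  descend from left to right, and the rectangle between \<open>P + i D\<close> and \<open>P + (i + 1) D\<close> has the area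
  \<open>(U + i) (V - i) d\<close>.
\<close>

definition center_lattice :: "real \<Rightarrow> real \<Rightarrow> (real \<times> real) set" where
  "center_lattice U V = pair_lattice (U - 1) (V / (U + V - 1)) 1 (- 1 / (U + V - 1))"

lemma pair_latticeI: "(of_int m * a + of_int n * c, of_int m * b + of_int n * e) \<in> pair_lattice a b c e"
  by (auto simp: pair_lattice_def)

lemma pair_lattice_add:
  assumes "(x, y) \<in> pair_lattice a b c e" "(x', y') \<in> pair_lattice a b c e"
  shows "(x + real n * x', y + real n * y') \<in> pair_lattice a b c e"
proof -
  obtain m k m' k' where "x = of_int m * a + of_int k * c" "y = of_int m * b + of_int k * e"
     "x' = of_int m' * a + of_int k' * c" "y' = of_int m' * b + of_int k' * e"
    using assms by (auto simp: pair_lattice_def)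
  then have "x + real n * x' = of_int (m + int n * m') * a + of_int (k + int n * k') * c"
     "y + real n * y' = of_int (m + int n * m') * b + of_int (k + int n * k') * e"
    by (auto simp: algebra_simps)
  then show ?thesis using pair_latticeI by metis
qed

text \<open>
  The rectangle in the middle of the arithmetic progression is the largest one: the
  difference of the two sides is \<open>i\<^sup>2 - i (V - U)\<close>.
\<close>

lemma shift_product_le:
  fixes i :: int and U V :: real
  assumes "\<bar>U - V\<bar> \<le> 1"
  shows "(U + of_int i) * (V - of_int i) \<le> U * V"
proof -
  have "\<bar>of_int i * (V - U)\<bar> \<le> \<bar>of_int i\<bar> * 1"
    unfolding abs_mult using assms by (intro mult_left_mono) auto
  also have "\<bar>of_int i\<bar> * 1 \<le> (of_int (i * i) :: real)"
  proof -
    have "\<bar>i\<bar> * 1 \<le> \<bar>i\<bar> * \<bar>i\<bar>" by (cases "i = 0") (simp, intro mult_left_mono, auto)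
    then show ?thesis by (metis abs_mult_self_eq mult.right_neutral of_int_abs of_int_le_iff)
  qed
  finally have "of_int i * (V - U) \<le> (of_int i * of_int i :: real)" by simp
  then show ?thesis by (simp add: algebra_simps)
qed

text \<open>
  To the right of the arithmetic progression \<open>P + i D\<close> the lattice continues along the expansion
  of \<open>s'\<close>, and to the left, after exchanging the coordinates, along that of \<open>s\<close>. There the areas
  are bounded by \<open>cf_max\<close>. In between, a box is confined to one of the rectangles of the
  progression.
\<close>

lemma center_box_bound:
  assumes s: "s \<in> cf_set" "s' \<in> cf_set" and n: "2 \<le> n" "2 \<le> n'"
    and U: "U = real n + 1 / s" and V: "V = real n' + 1 / s'" and UV: "\<bar>U - V\<bar> \<le> 1"
    and t: "U * V = t * (U + V - 1)" "cf_max \<le> t"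
    and XY: "0 < X" "0 < Y" and box: "empty_box (center_lattice U V) X Y"
  shows "X * Y \<le> t"
proof -
  define d where "d = 1 / (U + V - 1)"
  define L where "L = center_lattice U V"
  have s1: "1 < s" "1 < s'" using s cf_set_gt_1 by auto
  have n2: "2 \<le> real n" "2 \<le> real n'" using n by auto
  have gt: "2 < U" "2 < V" using s1 n2 zero_less_divide_1_iff[of s] zero_less_divide_1_iff[of s'] unfolding U V by linarith+
  have d: "0 < d" "d * (U + V - 1) = 1" using gt by (auto simp: d_def)
  have td: "t = U * V * d" using t(1) d(2) by (simp add: mult.assoc mult.commute)
  have L_eq: "L = pair_lattice (U - 1) (V * d) 1 (- d)"
    by (simp add: L_def center_lattice_def d_def)
  have chain: "(U - 1 + of_int i, (V - of_int i) * d) \<in> L" for i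
    using pair_latticeI[of 1 "U - 1" i 1 "V * d" "- d"] by (simp add: L_eq algebra_simps)
  have D: "(1, - d) \<in> L" "(- 1, d) \<in> L"
    using pair_latticeI[of 0 "U - 1" 1 1 "V * d" "- d"] pair_latticeI[of 0 "U - 1" "-1" 1 "V * d" "- d"]
    by (simp_all add: L_eq)
  have L_add: "(x + real n * x', y + real n * y') \<in> L" if "(x, y) \<in> L" "(x', y') \<in> L" for x y x' y' n
    using that pair_lattice_add unfolding L_eq by blast
  have box: "empty_box L X Y" using box by (simp add: L_def)
  have run: "X * Y \<le> t" if "X \<le> U + of_int i" "Y \<le> (V - of_int i) * d" for i :: int
  proof -
    have "X * Y \<le> (U + of_int i) * ((V - of_int i) * d)"
      using that XY by (intro mult_mono) auto
    also have "\<dots> \<le> U * V * d"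
      using mult_right_mono[OF shift_product_le[OF UV, of i], of d] d by (simp add: mult.assoc)
    finally show ?thesis by (simp add: td)
  qed
  \<comment> \<open>The progression is left at \<open>i = n' - 1\<close> and at \<open>i = 2 - n\<close>, where the ratios \<open>y / dy\<close> and
    \<open>x / dx\<close> have integer part 1, and so \<open>1 + 1 / s'\<close> and \<open>1 + 1 / s\<close> are in the Cantor set.\<close>
  consider (right) "U + real n' - 2 \<le> X" | (top) "(V + real n - 2) * d \<le> Y"
    | (left) "X < U + 1 - real n" "Y < (V + real n - 2) * d"
    | (mid) "U + 1 - real n \<le> X" "X < U + real n' - 2"
    by linarith
  then show ?thesis
  proof cases
    case right
    have "X * Y \<le> cf_max"
    proof (rule tail_box_bound[OF L_add box XY(2)])
      show "1 + 1 / s' \<in> cf_set" using cf_set_Cons[OF s(2), of 1] by simp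
      show "(U + real n' - 2, (1 + 1 / s') * d) \<in> L"
        using chain[of "int n' - 1"] by (simp add: V algebra_simps)
      show "(U + real n' - 2) * d + 1 * ((1 + 1 / s') * d) = 1"
        using d(2) by (simp add: V algebra_simps)
    qed (use D d gt n2 right in auto)
    then show ?thesis using t(2) by simp
  next
    case top
    have "Y * X \<le> cf_max"
    proof (rule tail_box_bound[of "prod.swap ` L"])
      show "(x + real n * x', y + real n * y') \<in> prod.swap ` L"
        if "(x, y) \<in> prod.swap ` L" "(x', y') \<in> prod.swap ` L" for x y x' y' n
        using that L_add by auto
      show "empty_box (prod.swap ` L) Y X" using box by (auto simp: empty_box_def)
      show "1 + 1 / s \<in> cf_set" using cf_set_Cons[OF s(1), of 1] by simp
      show "((V + real n - 2) * d, (1 + 1 / s) * 1) \<in> prod.swap ` L"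
        using imageI[OF chain[of "2 - int n"], of prod.swap] by (simp add: U algebra_simps)
      show "(d, - 1) \<in> prod.swap ` L" using imageI[OF D(2), of prod.swap] by simp
      show "(V + real n - 2) * d * 1 + d * ((1 + 1 / s) * 1) = 1"
        using d(2) by (simp add: U algebra_simps)
    qed (use d gt n2 top XY in auto)
    then show ?thesis using t(2) by (simp add: mult.commute)
  next
    case left
    have "(V + real n - 2) * d \<le> (V + real n - 1) * d" using d by (intro mult_right_mono) auto
    then show ?thesis using left run[of "1 - int n"] by (simp add: algebra_simps)
  next
    case mid
    define i where "i = \<lfloor>X - U + 1\<rfloor>"
    have i: "of_int i \<le> X - U + 1" "X - U + 1 < of_int i + 1"
      unfolding i_def by linarith+
    have "of_int i < of_int (int n') - (1::real)" using i mid by simp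
    then have "i < int n' - 1" by (metis of_int_1 of_int_diff of_int_less_iff)
    moreover have "of_int (1 - int n) < (of_int i :: real)" using i mid by simp
    then have "1 - int n < i" by linarith
    ultimately have "real_of_int i \<le> real n' - 2" "2 - real n \<le> real_of_int i" by linarith+
    moreover have "0 < 1 / s" "0 < 1 / s'" using s1 by auto
    ultimately have "0 < U - 1 + of_int i" "0 \<le> V - of_int i" unfolding U V by linarith+
    then have "Y < (V - of_int i) * d"
      using empty_boxD[OF box chain[of i]] d i by simp
    then show ?thesis using run[of i] i by simp
  qed
qed

text \<open>
  A point \<open>m P + n D\<close> with \<open>m \<le> -1\<close> has a negative coordinate. For \<open>m \<ge> 1\<close> the upper bounds on the two
  coordinates leave no integer for \<open>n\<close>.
\<close>

lemma center_box_empty: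
  assumes UV: "1 \<le> U" "1 \<le> V" "X < U" "Y < V / (U + V - 1)"
  shows "empty_box (center_lattice U V) X Y"
proof -
  define d where "d = 1 / (U + V - 1)"
  have d: "0 < d" using UV by (auto simp: d_def)
  have zero: "m = 0 \<and> n = 0" if *: "0 \<le> of_int m * (U - 1) + of_int n" "of_int m * (U - 1) + of_int n \<le> X"
    "0 \<le> (of_int m * V - of_int n) * d" "(of_int m * V - of_int n) * d \<le> Y" for m n :: int
  proof -
    have y0: "of_int n \<le> of_int m * V" using *(3) d by (simp add: zero_le_mult_iff)
    have "(of_int m * V - of_int n) * d < V * d" using *(4) UV(4) by (simp add: d_def)
    then have y1: "of_int m * V - of_int n < V" using d by simp
    have x1: "of_int m * (U - 1) + of_int n < U" using *(2) UV by simp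
    consider "m \<le> -1" | "m = 0" | "m = 1" | "2 \<le> m" by linarith
    then show ?thesis
    proof cases
      case 1
      then have "of_int m * (U - 1) \<le> - 1 * (U - 1)" "of_int m * V \<le> - 1 * V"
        using UV by (intro mult_right_mono; simp)+
      then show ?thesis using y0 *(1) UV by simp
    next
      case 2
      then show ?thesis using y0 *(1) by simp
    next
      case 3
      then show ?thesis using y1 x1 by simp
    next
      case 4
      then have "2 * (U - 1) \<le> of_int m * (U - 1)" "2 * V \<le> of_int m * V"
        using UV by (intro mult_right_mono; simp)+
      moreover have False if "2 * (U - 1) \<le> a" "2 * V \<le> b" "b - k < V" "a + k < U" for a b k
        using that UV(1,2) by simp
      ultimately have False using y1 x1 by blast
      then show ?thesis ..
    qed
  qed
  have "x = 0 \<and> y = 0" if xy: "(x, y) \<in> center_lattice U V" "0 \<le> x" "x \<le> X" "0 \<le> y" "y \<le> Y" for x y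
  proof -
    obtain m n :: int where "x = of_int m * (U - 1) + of_int n" "y = (of_int m * V - of_int n) * d"
      using xy(1) by (auto simp: center_lattice_def pair_lattice_def d_def diff_divide_distrib)
    then show ?thesis using zero[of m n] xy by auto
  qed
  then show ?thesis by (auto simp: empty_box_def)
qed

section \<open>Spectral values from balanced pairs\<close>

lemma pair_lattice_realize:
  assumes "\<bar>a * e - b * c\<bar> = 1"
  shows "\<exists>\<Lambda>. unimodular_lattice \<Lambda> \<and>
    (\<forall>X Y. admissible \<Lambda> X Y \<longleftrightarrow> 0 < X \<and> 0 < Y \<and> empty_box (pair_lattice a b c e) X Y)"
proof -
  define A B :: "real^2" where "A = vector [a, b]" and "B = vector [c, e]"
  have uni: "unimodular_lattice (lattice_span A B)"
    unfolding unimodular_lattice_def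
    using assms by (intro exI[of _ A] exI[of _ B]) (simp add: A_def B_def det_2)
  have in_span: "0 \<in> lattice_span A B"
    unfolding lattice_span_def by (auto intro!: exI[of _ "0::int"])
  have coords: "(\<lambda>v. (v $ 1, v $ 2)) ` lattice_span A B = pair_lattice a b c e"
  proof -
    have "lattice_span A B = range (\<lambda>(m :: int, n :: int). of_int m *\<^sub>R A + of_int n *\<^sub>R B)"
      "pair_lattice a b c e = range (\<lambda>(m :: int, n :: int). (of_int m * a + of_int n * c, of_int m * b + of_int n * e))"
      unfolding lattice_span_def pair_lattice_def image_def by auto
    then show ?thesis by (simp add: image_image case_prod_beta A_def B_def)
  qed
  have "admissible (lattice_span A B) X Y \<longleftrightarrow> 0 < X \<and> 0 < Y \<and> empty_box (pair_lattice a b c e) X Y" for X Y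
  proof -
    have mem: "v \<in> cbox 0 (vector [X, Y]) \<longleftrightarrow> 0 \<le> v $ 1 \<and> v $ 1 \<le> X \<and> 0 \<le> v $ 2 \<and> v $ 2 \<le> Y"
      for v :: "real^2" by (auto simp: mem_box_cart forall_2)
    have zero: "v = 0 \<longleftrightarrow> v $ 1 = 0 \<and> v $ 2 = 0" for v :: "real^2"
      by (simp add: vec_eq_iff forall_2)
    have "empty_box (pair_lattice a b c e) X Y \<longleftrightarrow>
        (\<forall>v\<in>lattice_span A B. v \<in> cbox 0 (vector [X, Y]) \<longrightarrow> v = 0)"
      unfolding coords[symmetric] empty_box_def mem zero by (simp add: imp_conjL)
    moreover have "0 < X \<Longrightarrow> 0 < Y \<Longrightarrow> 0 \<in> cbox 0 (vector [X, Y] :: real^2)"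
      unfolding mem by simp
    ultimately show ?thesis using in_span unfolding admissible_def by blast
  qed
  with uni show ?thesis by blast
qed

lemma kappa_plus_eqI:
  assumes "0 < x" "0 < y"
    and le: "\<And>X Y. admissible \<Lambda> X Y \<Longrightarrow> X * Y \<le> x * y"
    and adm: "\<And>X Y. 0 < X \<Longrightarrow> X < x \<Longrightarrow> 0 < Y \<Longrightarrow> Y < y \<Longrightarrow> admissible \<Lambda> X Y"
  shows "kappa_plus \<Lambda> = ennreal (x * y)"
  unfolding kappa_plus_def
proof (rule antisym)
  show "Sup {ennreal (X * Y) | X Y. admissible \<Lambda> X Y} \<le> ennreal (x * y)"
    using le by (auto intro!: Sup_least ennreal_leI)
  let ?f = "\<lambda>n. x * (1 - inverse (real (Suc (Suc n)))) * (y * (1 - inverse (real (Suc (Suc n)))))"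
  have "?f \<longlonglongrightarrow> x * (1 - 0) * (y * (1 - 0))"
    by (intro tendsto_intros LIMSEQ_Suc[OF LIMSEQ_inverse_real_of_nat])
  then have lim: "(\<lambda>n. ennreal (?f n)) \<longlonglongrightarrow> ennreal (x * y)"
    by (intro tendsto_ennrealI) simp
  show "ennreal (x * y) \<le> Sup {ennreal (X * Y) | X Y. admissible \<Lambda> X Y}"
  proof (rule LIMSEQ_le_const2[OF lim], intro exI allI impI)
    fix n :: nat
    have "0 < 1 - inverse (real (Suc (Suc n)))" "1 - inverse (real (Suc (Suc n))) < 1"
      by (auto simp: field_simps)
    then have "admissible \<Lambda> (x * (1 - inverse (real (Suc (Suc n))))) (y * (1 - inverse (real (Suc (Suc n)))))"
      using assms(1,2) by (intro adm mult_pos_pos) (simp_all only: mult_less_cancel_left2 not_less, auto)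
    then show "ennreal (?f n) \<le> Sup {ennreal (X * Y) | X Y. admissible \<Lambda> X Y}"
      by (intro Sup_upper) blast
  qed
qed

text \<open>
  Every rectangle that is strictly smaller than \<open>U \<times> V / (U + V - 1)\<close> in both
  directions is admissible, and no admissible rectangle has a larger area.
\<close>

lemma balanced_pair_in_MG2_plus:
  assumes s: "s \<in> cf_set" "s' \<in> cf_set" and n: "2 \<le> n" "2 \<le> n'"
    and U: "U = real n + 1 / s" and V: "V = real n' + 1 / s'" and UV: "\<bar>U - V\<bar> \<le> 1"
    and t: "U * V = t * (U + V - 1)" "cf_max \<le> t"
  shows "ennreal t \<in> MG2_plus"
proof -
  have "0 < 1 / s" "0 < 1 / s'" using s cf_set_gt_1 by fastforce+
  moreover have "2 \<le> real n" "2 \<le> real n'" using n by auto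
  ultimately have gt: "1 < U" "1 < V" unfolding U V by linarith+
  have td: "t = U * (V / (U + V - 1))" using t gt by (simp add: field_simps)
  have "\<bar>(U - 1) * (- 1 / (U + V - 1)) - V / (U + V - 1) * 1\<bar> = 1"
  proof -
    have "(U - 1) * (- 1 / (U + V - 1)) - V / (U + V - 1) * 1 = - 1"
      using gt by (simp add: divide_simps)
    then show ?thesis by simp
  qed
  from pair_lattice_realize[OF this] obtain \<Lambda> where uni: "unimodular_lattice \<Lambda>"
    and adm: "\<And>X Y. admissible \<Lambda> X Y \<longleftrightarrow> 0 < X \<and> 0 < Y \<and> empty_box (center_lattice U V) X Y"
    unfolding center_lattice_def by blast
  have "kappa_plus \<Lambda> = ennreal (U * (V / (U + V - 1)))"
  proof (rule kappa_plus_eqI)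
    show "X * Y \<le> U * (V / (U + V - 1))" if "admissible \<Lambda> X Y" for X Y
      using center_box_bound[OF s n U V UV t, of X Y] that adm td by simp
    show "admissible \<Lambda> X Y" if "0 < X" "X < U" "0 < Y" "Y < V / (U + V - 1)" for X Y
      using that gt center_box_empty[of U V X Y] by (simp add: adm)
  qed (use gt in auto)
  then show ?thesis using uni td unfolding MG2_plus_def by (metis (mono_tags, lifting) mem_Collect_eq)
qed

section \<open>Solving for a balanced pair\<close>

text \<open>
  Up to the positive factor \<open>x + y - 1\<close>, this is the amount by which the area \<open>(x + i) (y - i) / (x + y - 1)\<close>
  exceeds \<open>t\<close>. The factored form shows that it is increasing in both variables beyond \<open>t + 1\<close>. The
  points \<open>x\<close> and \<open>y\<close> of the window may differ by more than 1, and then the largest rectangle is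
  not the one at \<open>i = 0\<close>; this is why the maximum over \<open>i \<in> {-1, 0, 1}\<close> has to vanish.
\<close>

definition defect :: "real \<Rightarrow> real \<Rightarrow> real \<Rightarrow> real \<Rightarrow> real" where
  "defect t i x y = (x + i - t) * (y - i - t) - (t\<^sup>2 - t)"

definition max_defect :: "real \<Rightarrow> real \<Rightarrow> real \<Rightarrow> real" where
  "max_defect t x y = max (defect t 0 x y) (max (defect t 1 x y) (defect t (-1) x y))"

text \<open>
  For \<open>l \<ge> t + 5\<close> and \<open>u \<le> l + 2\<close>, the two factors of the product stay between two positive bounds
  whose ratio is at most 2.
\<close>

lemma exchange_defect:
  assumes i: "\<bar>i\<bar> \<le> 1" and l: "t + 5 \<le> l" and u: "u \<le> l + 2"
  shows "exchange 2 l u (defect t i)"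
  unfolding exchange_def
proof (intro allI impI, elim conjE)
  fix c d v w
  assume *: "l \<le> c" "c \<le> d" "d \<le> u" "l \<le> v" "v \<le> w" "w \<le> u" "2 * (d - c) \<le> w - v"
  have "v - i - t \<le> 2 * (c + i - t)" "0 \<le> c + i - t" using * i l u by (auto simp: abs_le_iff)
  then have "(d - c) * (v - i - t) \<le> (d - c) * (2 * (c + i - t))"
    using * by (intro mult_left_mono) auto
  also have "\<dots> = 2 * (d - c) * (c + i - t)" by (simp add: algebra_simps)
  also have "\<dots> \<le> (w - v) * (c + i - t)"
    using * \<open>0 \<le> c + i - t\<close> by (intro mult_right_mono) auto
  finally show "defect t i d v \<le> defect t i c w"
    by (simp add: defect_def algebra_simps)
qed

lemma exchange_max:
  "exchange k l u F \<Longrightarrow> exchange k l u G \<Longrightarrow> exchange k l u (\<lambda>x y. max (F x y) (G x y))"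
  unfolding exchange_def by (intro allI impI max.mono) auto

lemma max_defect_sym: "max_defect t y x = max_defect t x y"
proof -
  have "defect t 0 y x = defect t 0 x y" "defect t 1 y x = defect t (-1) x y" "defect t (-1) y x = defect t 1 x y"
    by (simp_all add: defect_def algebra_simps)
  then show ?thesis by (simp add: max_defect_def max.commute)
qed

text \<open>
  The number \<open>z\<close> solves \<open>z\<^sup>2 / (2 z - 1) = t\<close>, and \<open>R\<close> is chosen such that \<open>z\<close> lies in the hull
  \<open>{l..u}\<close> of the window. The maximal defect then changes sign along the diagonal of the window, so it
  vanishes at some \<open>(x, y)\<close> in the window. Shifting by the index \<open>i\<close> at which the maximum is attained
  turns \<open>(x, y)\<close> into a balanced pair.
\<close>

lemma real_in_MG2_plus:
  assumes t: "50 \<le> t"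
  shows "ennreal t \<in> MG2_plus"
proof -
  define z where "z = t + sqrt (t\<^sup>2 - t)"
  define R where "R = nat \<lfloor>z - 1 / cf_max\<rfloor>"
  define l where "l = real R + 1 / cf_max"
  define u where "u = real (Suc R) + 1 / cf_min"
  have "50 * t \<le> t\<^sup>2" using t by (simp add: power2_eq_square)
  then have t2: "0 \<le> t\<^sup>2 - t" "7\<^sup>2 \<le> t\<^sup>2 - t" using t by auto
  have z: "t + 7 \<le> z" "(z - t)\<^sup>2 = t\<^sup>2 - t"
    using t2 real_le_rsqrt[OF t2(2)] by (auto simp: z_def)
  have "1 / cf_max < 1" "0 < 1 / cf_max" using cf_max_bounds by auto
  then have R: "real R \<le> z - 1 / cf_max" "z - 1 / cf_max < real R + 1"
    using z t unfolding R_def by linarith+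
  have lu: "t + 5 \<le> l" "u \<le> l + 2" "l \<le> z" "z \<le> u" "l \<le> u"
    using R z cf_max_bounds unfolding l_def u_def inverse_cf_max inverse_cf_min by auto
  have ex: "exchange 2 l u (max_defect t)"
    unfolding max_defect_def[abs_def] by (intro exchange_max exchange_defect lu) auto
  have cont: "continuous_on UNIV (\<lambda>(x, y). max_defect t x y)"
    unfolding max_defect_def defect_def case_prod_beta by (intro continuous_intros)
  have low: "max_defect t l l \<le> 0"
  proof -
    have "(l - t)\<^sup>2 \<le> (z - t)\<^sup>2" using lu by (intro power_mono) auto
    then show ?thesis using z(2) by (simp add: max_defect_def defect_def power2_eq_square algebra_simps)
  qed
  have high: "0 \<le> max_defect t u u"
  proof -
    have "(z - t)\<^sup>2 \<le> (u - t)\<^sup>2" using lu z by (intro power_mono) auto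
    then have "0 \<le> defect t 0 u u" using z(2) by (simp add: defect_def power2_eq_square)
    then show ?thesis by (simp add: max_defect_def)
  qed
  have root: "(l, real R + 1 / cf_min, real (Suc R) + 1 / cf_max, u) \<in> cf_tree R"
    by (simp add: cf_tree_def l_def u_def)
  obtain x y where xy: "x \<in> cf_window R" "y \<in> cf_window R" "x \<in> {l..u}" "y \<in> {l..u}"
      and zero: "max_defect t x y = 0"
    using cf_tree.exists_zero[OF root ex _ cont low high] ex by (auto simp: max_defect_sym)
  obtain n s where n: "n = R \<or> n = Suc R" and s: "s \<in> cf_set" and x: "x = real n + 1 / s"
    using xy(1) unfolding cf_window_def by blast
  obtain n' s' where n': "n' = R \<or> n' = Suc R" and s': "s' \<in> cf_set" and y: "y = real n' + 1 / s'"
    using xy(2) unfolding cf_window_def by blast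
  have "50 \<le> real R" using R z t \<open>1 / cf_max < 1\<close> by linarith
  then have R3: "50 \<le> R" by simp
  have le0: "defect t 0 x y \<le> 0" "defect t 1 x y \<le> 0" "defect t (-1) x y \<le> 0"
    and zero_cases: "defect t 0 x y = 0 \<or> defect t 1 x y = 0 \<or> defect t (-1) x y = 0"
    using zero unfolding max_defect_def max_def by (auto split: if_splits)
  have dist: "\<bar>x - y\<bar> \<le> 2" using xy lu by auto
  have MG: "ennreal t \<in> MG2_plus" if i: "i = 0 \<or> i = 1 \<or> i = -1" and "defect t (of_int i) x y = 0"
      "\<bar>(x + of_int i) - (y - of_int i)\<bar> \<le> 1" for i :: int
  proof (rule balanced_pair_in_MG2_plus[OF s s'])
    show "2 \<le> nat (int n + i)" "2 \<le> nat (int n' - i)" using i n n' R3 by auto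
    show "x + of_int i = real (nat (int n + i)) + 1 / s" "y - of_int i = real (nat (int n' - i)) + 1 / s'"
      using i n n' R3 by (auto simp: x y of_nat_nat)
    show "(x + of_int i) * (y - of_int i) = t * (x + of_int i + (y - of_int i) - 1)"
      using that(2) by (simp add: defect_def algebra_simps power2_eq_square)
  qed (use that cf_max_bounds t in auto)
  \<comment> \<open>Comparison of the defects at neighbouring indices bounds the difference of the shifted
    coordinates by 1.\<close>
  have d: "defect t 1 x y - defect t 0 x y = y - x - 1" "defect t (-1) x y - defect t 0 x y = x - y - 1"
    by (simp_all add: defect_def algebra_simps)
  show ?thesis using zero_cases
  proof (elim disjE)
    assume "defect t 0 x y = 0"
    then show ?thesis using MG[of 0] le0 d by (simp add: abs_le_iff)
  next
    assume "defect t 1 x y = 0"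
    then show ?thesis using MG[of 1] le0 d dist by (simp add: abs_le_iff)
  next
    assume "defect t (-1) x y = 0"
    then show ?thesis using MG[of "-1"] le0 d dist by (simp add: abs_le_iff)
  qed
qed

section \<open>The value infinity\<close>

text \<open>
  The Liouville type number \<open>\<Sum>k. 2 ^ (- (3 ^ k))\<close>: its partial sums have denominators
  \<open>q = 2 ^ (3 ^ n)\<close> and errors of at most \<open>2 / q\<^sup>3\<close>, and they lie below the number.
\<close>

lemma approximable_from_below:
  obtains \<sigma> :: real where "\<And>\<epsilon>. 0 < \<epsilon> \<Longrightarrow> \<exists>q::nat. \<exists>p::int. 0 < q \<and> of_int p / q < \<sigma> \<and> (real q)\<^sup>2 * (\<sigma> - of_int p / q) < \<epsilon>"
proof -
  define f :: "nat \<Rightarrow> real" where "f k = (1 / 2) ^ 3 ^ k" for k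
  have k_le: "k \<le> 3 ^ k" for k :: nat
    by (rule less_imp_le[OF less_exp[THEN less_le_trans]]) (simp add: power_mono)
  have f_pos: "0 < f k" for k by (simp add: f_def)
  have "summable f"
  proof (rule summable_comparison_test')
    show "norm (f k) \<le> (1 / 2) ^ k" for k
      using k_le[of k] by (simp add: f_def power_decreasing)
  qed (simp add: summable_geometric)
  then have shift: "summable (\<lambda>k. f (k + Suc n))" for n
    by (rule summable_ignore_initial_segment)
  have tail: "(\<Sum>k. f (k + Suc n)) \<le> 2 * f (Suc n)" for n
  proof -
    have "(\<Sum>k. f (k + Suc n)) \<le> (\<Sum>k. f (Suc n) * (1 / 2) ^ k)"
    proof (rule suminf_le)
      fix k
      have "(3::nat) ^ Suc n + k \<le> 3 ^ (k + Suc n)"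
      proof -
        have "k + 1 \<le> 3 ^ k" by (induction k) auto
        then have "3 ^ Suc n * (k + 1) \<le> 3 ^ Suc n * (3::nat) ^ k" by (rule mult_left_mono) simp
        then have "3 ^ Suc n * k + 3 ^ Suc n \<le> (3::nat) ^ (k + Suc n)"
          by (simp only: distrib_left distrib_right mult_1_left mult_1_right power_add mult.commute)
        moreover have "k \<le> 3 ^ Suc n * k" by simp
        ultimately show ?thesis by (metis add.commute add_le_mono1 le_trans)
      qed
      then have "(1 / 2 :: real) ^ 3 ^ (k + Suc n) \<le> (1 / 2) ^ (3 ^ Suc n + k)"
        by (intro power_decreasing) auto
      then show "f (k + Suc n) \<le> f (Suc n) * (1 / 2) ^ k" by (simp add: f_def power_add)
    qed (use shift[of n] in \<open>auto intro!: summable_mult summable_geometric\<close>)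
    also have "\<dots> = 2 * f (Suc n)"
      by (subst suminf_mult) (auto simp: suminf_geometric summable_geometric)
    finally show ?thesis .
  qed
  have split: "suminf f = (\<Sum>k. f (k + Suc n)) + sum f {..n}" for n
    using suminf_split_initial_segment[OF \<open>summable f\<close>, of "Suc n"] by (simp add: lessThan_Suc_atMost)
  have tail_pos: "0 < (\<Sum>k. f (k + Suc n))" for n
    by (intro suminf_pos shift f_pos)
  show ?thesis
  proof (rule that[of "suminf f"])
    fix \<epsilon> :: real assume "0 < \<epsilon>"
    then obtain n where n: "(1 / 2) ^ n < \<epsilon> / 2"
      using real_arch_pow_inv[of "\<epsilon> / 2" "1 / 2"] by auto
    define q :: nat where "q = 2 ^ 3 ^ n"
    define p :: int where "p = (\<Sum>k\<le>n. 2 ^ (3 ^ n - 3 ^ k))"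
    have pq: "of_int p / q = sum f {..n}"
    proof -
      have "2 ^ (3 ^ n - 3 ^ k) / 2 ^ 3 ^ n = f k" if "k \<le> n" for k
        using that by (simp add: f_def power_diff power_increasing power_divide)
      then show ?thesis
        by (simp add: p_def q_def sum_divide_distrib)
    qed
    have "(real q)\<^sup>2 * (suminf f - of_int p / q) \<le> (real q)\<^sup>2 * (2 * f (Suc n))"
      using tail[of n] split[of n] by (intro mult_left_mono) (auto simp: pq)
    also have "\<dots> = 2 * (1 / 2) ^ 3 ^ n"
    proof -
      have "(3::nat) ^ Suc n = 3 ^ n + 3 ^ n + 3 ^ n" by simp
      then show ?thesis
        unfolding f_def q_def by (simp only: power_add) (simp add: power2_eq_square power_divide)
    qed
    also have "\<dots> \<le> 2 * (1 / 2) ^ n"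
      using k_le[of n] by (simp add: power_decreasing)
    also have "\<dots> < \<epsilon>" using n by simp
    finally have "(real q)\<^sup>2 * (suminf f - of_int p / q) < \<epsilon>" .
    moreover have "of_int p / q < suminf f" using tail_pos[of n] split[of n] by (simp add: pq)
    ultimately show "\<exists>q::nat. \<exists>p::int. 0 < q \<and> of_int p / q < suminf f \<and> (real q)\<^sup>2 * (suminf f - of_int p / q) < \<epsilon>"
      by (intro exI[of _ q] exI[of _ p]) (simp add: q_def)
  qed
qed

text \<open>
  The lattice consists of the points \<open>(m, k - m \<sigma>)\<close>. Write \<open>\<sigma> = p / q + e\<close>. The height of such a
  point, multiplied by \<open>q\<close>, is an integer minus \<open>m e q\<close>, and \<open>m e q\<close> lies between 0 and \<open>1 / 4\<close> in
  the box. As the height is at most \<open>1 / (4 q)\<close>, the integer must be 0. Since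
  \<open>e > 0\<close>, that is, since \<open>p / q\<close> approximates \<open>\<sigma>\<close> from below, a height that is not negative then forces \<open>m = 0\<close>.
\<close>

lemma thin_box_empty:
  assumes q: "0 < (q::nat)" and p: "of_int p / q < \<sigma>"
  shows "empty_box (pair_lattice 1 (- \<sigma>) 0 1) (1 / (4 * q * (\<sigma> - of_int p / q))) (1 / (4 * q))"
proof -
  define e where "e = \<sigma> - of_int p / q"
  have e: "0 < e" "\<sigma> = of_int p / q + e" using p by (auto simp: e_def)
  have q1: "1 \<le> real q" using q by simp
  have zero: "m = 0 \<and> k = 0" if *: "0 \<le> real_of_int m" "of_int m \<le> 1 / (4 * q * e)" 
     "0 \<le> of_int k - of_int m * \<sigma>" "of_int k - of_int m * \<sigma> \<le> 1 / (4 * q)" for m k :: int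
  proof -
    define j where "j = k * int q - m * p"
    have y: "(of_int k - of_int m * \<sigma>) * q = of_int j - of_int m * e * q"
      using q by (simp add: e(2) j_def field_simps)
    have "0 \<le> of_int j - of_int m * e * q" unfolding y[symmetric] using *(3) by simp
    moreover have "of_int j - of_int m * e * q \<le> 1 / 4"
    proof -
      have "(of_int k - of_int m * \<sigma>) * q \<le> 1 / (4 * q) * q" using *(4) by (intro mult_right_mono) auto
      then show ?thesis unfolding y using q by simp
    qed
    moreover have "of_int m * e * q \<le> 1 / 4"
    proof -
      have "of_int m * (e * q) \<le> 1 / (4 * q * e) * (e * q)" using *(2) e by (intro mult_right_mono) auto
      then show ?thesis using q e by simp
    qed
    ultimately have "of_int j < (1::real)" "of_int m * e * q \<le> of_int j" by linarith+
    then have "j \<le> 0" by simp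
    then have "of_int m * e * q \<le> 0" using \<open>of_int m * e * q \<le> of_int j\<close> by linarith
    then have m: "m = 0" using *(1) e q by (auto simp: mult_le_0_iff)
    have "1 / (4 * real q) < 1" using q1 by simp
    then have "of_int k < (1::real)" using *(4) m by simp
    then show ?thesis using *(3) m by simp
  qed
  have "x = 0 \<and> y = 0" if xy: "(x, y) \<in> pair_lattice 1 (- \<sigma>) 0 1" "0 \<le> x" "x \<le> 1 / (4 * q * e)"
    "0 \<le> y" "y \<le> 1 / (4 * q)" for x y
  proof -
    obtain m k :: int where "x = of_int m" "y = of_int k - of_int m * \<sigma>"
      using xy(1) by (auto simp: pair_lattice_def)
    then show ?thesis using zero[of m k] xy by auto
  qed
  then show ?thesis by (auto simp: empty_box_def e_def)
qed

lemma infinity_in_MG2_plus: "\<infinity> \<in> MG2_plus"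
proof -
  obtain \<sigma> where \<sigma>: "\<And>\<epsilon>. 0 < \<epsilon> \<Longrightarrow> \<exists>q::nat. \<exists>p::int. 0 < q \<and> of_int p / q < \<sigma> \<and> (real q)\<^sup>2 * (\<sigma> - of_int p / q) < \<epsilon>"
    using approximable_from_below by blast
  obtain \<Lambda> where uni: "unimodular_lattice \<Lambda>"
    and adm: "\<And>X Y. admissible \<Lambda> X Y \<longleftrightarrow> 0 < X \<and> 0 < Y \<and> empty_box (pair_lattice 1 (- \<sigma>) 0 1) X Y"
    using pair_lattice_realize[of 1 1 "- \<sigma>" 0] by auto
  have "of_nat N \<le> kappa_plus \<Lambda>" for N :: nat
  proof -
    obtain q :: nat and p :: int where qp: "0 < q" "of_int p / q < \<sigma>"
        "(real q)\<^sup>2 * (\<sigma> - of_int p / q) < 1 / (16 * (real N + 1))"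
      using \<sigma>[of "1 / (16 * (real N + 1))"] by auto
    define e where "e = \<sigma> - of_int p / q"
    have e: "0 < e" using qp by (simp add: e_def)
    define w where "w = (real q)\<^sup>2 * e"
    have w: "0 < w" "w * (16 * (real N + 1)) < 1"
      using qp e by (simp_all add: w_def e_def[symmetric] pos_less_divide_eq)
    then have "real N * (16 * w) \<le> 1" by (simp add: algebra_simps)
    then have "real N \<le> 1 / (16 * w)" using w by (simp add: pos_le_divide_eq)
    also have "\<dots> = 1 / (4 * q * e) * (1 / (4 * q))" by (simp add: w_def power2_eq_square)
    finally have "real N \<le> 1 / (4 * q * e) * (1 / (4 * q))" .
    then have "ennreal (real N) \<le> ennreal (1 / (4 * q * e) * (1 / (4 * q)))"
      by (rule ennreal_leI)
    also have "admissible \<Lambda> (1 / (4 * q * e)) (1 / (4 * q))"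
      using thin_box_empty[OF qp(1,2)] qp e by (simp add: adm e_def)
    then have "ennreal (1 / (4 * q * e) * (1 / (4 * q))) \<le> kappa_plus \<Lambda>"
      unfolding kappa_plus_def by (intro Sup_upper) blast
    finally show ?thesis by (simp add: ennreal_of_nat_eq_real_of_nat)
  qed
  then have "kappa_plus \<Lambda> = \<infinity>"
    by (simp add: ennreal_SUP_of_nat_eq_top flip: top_unique) (metis SUP_least ennreal_SUP_of_nat_eq_top infinity_ennreal_def)
  then show ?thesis using uni unfolding MG2_plus_def by (metis (mono_tags, lifting) mem_Collect_eq)
qed

theorem theorem55:
  "\<exists>K::real. 0 < K \<and> {ennreal K..\<infinity>} \<subseteq> MG2_plus"
proof (intro exI conjI subsetI)
  fix x assume x: "x \<in> {ennreal 50..\<infinity>}"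
  show "x \<in> MG2_plus"
  proof (cases x)
    case (real t)
    then have "50 \<le> t" using x by (auto simp: ennreal_le_iff2)
    then show ?thesis using real_in_MG2_plus real by simp
  qed (use infinity_in_MG2_plus in simp)
qed simp

end
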